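(* Let $\Phi$ be the root system of type $G_2$ with simple roots $a$ (short) and $b$ (long), let $N_{r,s}$ be the structure constants of the complex simple Lie algebra of type $G_2$ with respect to a Chevalley basis, and define $\epsilon_1,\dots,\epsilon_5$ by $N_{a,b}=\epsilon_1$, $N_{a,a+b}=2\epsilon_2$, $N_{a,2a+b}=3\epsilon_3$, $N_{b,3a+b}=\epsilon_4$, $\epsilon_5=\epsilon_1\epsilon_3/\epsilon_4$. Let $K$ be a field (or an associative commutative ring with identity), and let $x_r(t)$ ($r\in\Phi$, $t\in K$) be the root elements of the Chevalley group of type $G_2$ over $K$ attached to this Chevalley basis. With $[x,y]=x^{-1}y^{-1}xy$, the following identities hold for all $t,u\in K$. Positive roots: 1. $[x_b(u),x_a(t)]=x_{a+b}(-\epsilon_1tu)\,x_{2a+b}(\epsilon_1\epsilon_2t^2u)\,x_{3a+b}(-\epsilon_1\epsilon_2\epsilon_3t^3u)\,x_{3a+2b}(-\epsilon_2\epsilon_5t^3u^2)$ 2. $[x_a(u),x_b(t)]=x_{a+b}(\epsilon_1tu)\,x_{2a+b}(-\epsilon_1\epsilon_2tu^2)\,x_{3a+b}(\epsilon_1\epsilon_2\epsilon_3tu^3)\,x_{3a+2b}(-2\epsilon_2\epsilon_5t^2u^3)$ 3. $[x_{a+b}(u),x_a(t)]=x_{2a+b}(-2\epsilon_2tu)\,x_{3a+b}(3\epsilon_2\epsilon_3t^2u)\,x_{3a+2b}(-3\epsilon_2\epsilon_5tu^2)$ 4. $[x_{2a+b}(u),x_a(t)]=x_{3a+b}(-3\epsilon_3tu)$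 5. $[x_{3a+b}(u),x_b(t)]=x_{3a+2b}(-\epsilon_4tu)$ 6. $[x_{2a+b}(u),x_{a+b}(t)]=x_{3a+2b}(3\epsilon_5tu)$ Negative roots: 7. $[x_{-b}(u),x_{-a}(t)]=x_{-a-b}(\epsilon_1tu)\,x_{-2a-b}(\epsilon_1\epsilon_2t^2u)\,x_{-3a-b}(\epsilon_1\epsilon_2\epsilon_3t^3u)\,x_{-3a-2b}(-\epsilon_2\epsilon_5t^3u^2)$ 8. $[x_{-a}(u),x_{-b}(t)]=x_{-a-b}(-\epsilon_1tu)\,x_{-2a-b}(-\epsilon_1\epsilon_2tu^2)\,x_{-3a-b}(-\epsilon_1\epsilon_2\epsilon_3tu^3)\,x_{-3a-2b}(-2\epsilon_2\epsilon_5t^2u^3)$ 9. $[x_{-a-b}(u),x_{-a}(t)]=x_{-2a-b}(2\epsilon_2tu)\,x_{-3a-b}(3\epsilon_2\epsilon_3t^2u)\,x_{-3a-2b}(-3\epsilon_2\epsilon_5tu^2)$ 10. $[x_{-2a-b}(u),x_{-a}(t)]=x_{-3a-b}(3\epsilon_3tu)$ 11. $[x_{-3a-b}(u),x_{-b}(t)]=x_{-3a-2b}(\epsilon_4tu)$ 12. $[x_{-2a-b}(u),x_{-a-b}(t)]=x_{-3a-2b}(-3\epsilon_5tu)$ Positive and negative roots: 13. $[x_{-a-b}(u),x_a(t)]=x_{-b}(3\epsilon_1tu)$ 14. $[x_{-2a-b}(u),x_a(t)]=x_{-a-b}(2\epsilon_2tu)\,x_{-b}(3\epsilon_1\epsilon_2t^2u)\,x_{-3a-2b}(3\epsilon_2\epsilon_5tu^2)$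 15. $[x_{-3a-b}(u),x_a(t)]=x_{-2a-b}(\epsilon_3tu)\,x_{-a-b}(\epsilon_2\epsilon_3t^2u)\,x_{-b}(\epsilon_1\epsilon_2\epsilon_3t^3u)\,x_{-3a-2b}(\epsilon_2\epsilon_5t^3u^2)$ 16. $[x_a(u),x_{-3a-b}(t)]=x_{-2a-b}(-\epsilon_3tu)\,x_{-a-b}(-\epsilon_2\epsilon_3tu^2)\,x_{-b}(-\epsilon_1\epsilon_2\epsilon_3tu^3)\,x_{-3a-2b}(2\epsilon_2\epsilon_5t^2u^3)$ 17. $[x_b(u),x_{-a-b}(t)]=x_{-a}(\epsilon_1tu)\,x_{-2a-b}(-\epsilon_1\epsilon_2t^2u)\,x_{-3a-2b}(\epsilon_1\epsilon_2\epsilon_5t^3u)\,x_{-3a-b}(-\epsilon_2\epsilon_3t^3u^2)$ 18. $[x_{-a-b}(u),x_b(t)]=x_{-a}(-\epsilon_1tu)\,x_{-2a-b}(\epsilon_1\epsilon_2tu^2)\,x_{-3a-2b}(-\epsilon_1\epsilon_2\epsilon_5tu^3)\,x_{-3a-b}(-2\epsilon_2\epsilon_3t^2u^3)$ 19. $[x_{-3a-2b}(u),x_b(t)]=x_{-3a-b}(\epsilon_4tu)$ 20. $[x_{-a}(u),x_{a+b}(t)]=x_b(3\epsilon_1tu)$ 21. $[x_{-b}(u),x_{a+b}(t)]=x_a(-\epsilon_1tu)\,x_{2a+b}(-\epsilon_1\epsilon_2t^2u)\,x_{3a+2b}(-\epsilon_1\epsilon_2\epsilon_5t^3u)\,x_{3a+b}(-\epsilon_2\epsilon_3t^3u^2)$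 22. $[x_{a+b}(u),x_{-b}(t)]=x_a(\epsilon_1tu)\,x_{2a+b}(\epsilon_1\epsilon_2tu^2)\,x_{3a+2b}(\epsilon_1\epsilon_2\epsilon_5tu^3)\,x_{3a+b}(-2\epsilon_2\epsilon_3t^2u^3)$ 23. $[x_{-2a-b}(u),x_{a+b}(t)]=x_{-a}(-2\epsilon_2tu)\,x_b(-3\epsilon_1\epsilon_2t^2u)\,x_{-3a-b}(3\epsilon_2\epsilon_3tu^2)$ 24. $[x_{-3a-2b}(u),x_{a+b}(t)]=x_{-2a-b}(-\epsilon_5tu)\,x_{-a}(\epsilon_2\epsilon_5t^2u)\,x_b(\epsilon_1\epsilon_2\epsilon_5t^3u)\,x_{-3a-b}(\epsilon_2\epsilon_3t^3u^2)$ 25. $[x_{a+b}(u),x_{-3a-2b}(t)]=x_{-2a-b}(\epsilon_5tu)\,x_{-a}(-\epsilon_2\epsilon_5tu^2)\,x_b(-\epsilon_1\epsilon_2\epsilon_5tu^3)\,x_{-3a-b}(2\epsilon_2\epsilon_3t^2u^3)$ 26. $[x_{-a}(u),x_{2a+b}(t)]=x_{a+b}(2\epsilon_2tu)\,x_{3a+2b}(-3\epsilon_2\epsilon_5t^2u)\,x_b(-3\epsilon_1\epsilon_2tu^2)$ 27. $[x_{-a-b}(u),x_{2a+b}(t)]=x_a(-2\epsilon_2tu)\,x_{3a+b}(-3\epsilon_2\epsilon_3t^2u)\,x_{-b}(3\epsilon_1\epsilon_2tu^2)$ 28. $[x_{-3a-b}(u),x_{2a+b}(t)]=x_{-a}(-\epsilon_3tu)\,x_{a+b}(-\epsilon_2\epsilon_3t^2u)\,x_{3a+2b}(\epsilon_2\epsilon_3\epsilon_5t^3u)\,x_b(-\epsilon_1\epsilon_2t^3u^2)$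 29. $[x_{2a+b}(u),x_{-3a-b}(t)]=x_{-a}(\epsilon_3tu)\,x_{a+b}(\epsilon_2\epsilon_3tu^2)\,x_{3a+2b}(-\epsilon_2\epsilon_3\epsilon_5tu^3)\,x_b(-2\epsilon_1\epsilon_2t^2u^3)$ 30. $[x_{-3a-2b}(u),x_{2a+b}(t)]=x_{-a-b}(\epsilon_5tu)\,x_a(-\epsilon_2\epsilon_5t^2u)\,x_{3a+b}(-\epsilon_2\epsilon_3\epsilon_5t^3u)\,x_{-b}(\epsilon_1\epsilon_2t^3u^2)$ 31. $[x_{2a+b}(u),x_{-3a-2b}(t)]=x_{-a-b}(-\epsilon_5tu)\,x_a(\epsilon_2\epsilon_5tu^2)\,x_{3a+b}(\epsilon_2\epsilon_3\epsilon_5tu^3)\,x_{-b}(2\epsilon_1\epsilon_2t^2u^3)$ 32. $[x_{-a}(u),x_{3a+b}(t)]=x_{2a+b}(\epsilon_3tu)\,x_{a+b}(-\epsilon_2\epsilon_3tu^2)\,x_b(\epsilon_1\epsilon_2\epsilon_3tu^3)\,x_{3a+2b}(2\epsilon_2\epsilon_5t^2u^3)$ 33. $[x_{3a+b}(u),x_{-a}(t)]=x_{2a+b}(-\epsilon_3tu)\,x_{a+b}(\epsilon_2\epsilon_3t^2u)\,x_b(-\epsilon_1\epsilon_2\epsilon_3t^3u)\,x_{3a+2b}(\epsilon_2\epsilon_5t^3u^2)$ 34. $[x_{-2a-b}(u),x_{3a+b}(t)]=x_a(-\epsilon_3tu)\,x_{-a-b}(\epsilon_2\epsilon_3tu^2)\,x_{-3a-2b}(\epsilon_2\epsilon_3\epsilon_5tu^3)\,x_{-b}(-2\epsilon_1\epsilon_2t^2u^3)$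 35. $[x_{3a+b}(u),x_{-2a-b}(t)]=x_a(\epsilon_3tu)\,x_{-a-b}(-\epsilon_2\epsilon_3t^2u)\,x_{-3a-2b}(-\epsilon_2\epsilon_3\epsilon_5t^3u)\,x_{-b}(-\epsilon_1\epsilon_2t^3u^2)$ 36. $[x_{-3a-2b}(u),x_{3a+b}(t)]=x_{-b}(-\epsilon_4tu)$ 37. $[x_{-a-b}(u),x_{3a+2b}(t)]=x_{2a+b}(-\epsilon_5tu)\,x_a(-\epsilon_2\epsilon_5tu^2)\,x_{-b}(\epsilon_1\epsilon_2\epsilon_5tu^3)\,x_{3a+b}(2\epsilon_2\epsilon_3t^2u^3)$ 38. $[x_{3a+2b}(u),x_{-a-b}(t)]=x_{2a+b}(\epsilon_5tu)\,x_a(\epsilon_2\epsilon_5t^2u)\,x_{-b}(-\epsilon_1\epsilon_2\epsilon_5t^3u)\,x_{3a+b}(\epsilon_2\epsilon_3t^3u^2)$ 39. $[x_{-2a-b}(u),x_{3a+2b}(t)]=x_{a+b}(\epsilon_5tu)\,x_{-a}(\epsilon_2\epsilon_5tu^2)\,x_{-3a-b}(-\epsilon_2\epsilon_3\epsilon_5tu^3)\,x_b(2\epsilon_1\epsilon_2t^2u^3)$ 40. $[x_{3a+2b}(u),x_{-2a-b}(t)]=x_{a+b}(-\epsilon_5tu)\,x_{-a}(-\epsilon_2\epsilon_5t^2u)\,x_{-3a-b}(\epsilon_2\epsilon_3\epsilon_5t^3u)\,x_b(\epsilon_1\epsilon_2t^3u^2)$ 41. $[x_{-3a-b}(u),x_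{3a+2b}(t)]=x_b(-\epsilon_4tu)$
   Context: Root system: in Euclidean $\mathbb{R}^3$ with orthonormal basis $\varepsilon_1,\varepsilon_2,\varepsilon_3$ put $a=\varepsilon_1-\varepsilon_2$, $b=-2\varepsilon_1+\varepsilon_2+\varepsilon_3$, so $(a,a)=2$, $(b,b)=6$, $(a,b)=-3$. The root system $\Phi$ of type $G_2$ is $\{\pm a,\pm b,\pm(a+b),\pm(2a+b),\pm(3a+b),\pm(3a+2b)\}$, with fundamental roots $a,b$. Structure constants: the complex simple Lie algebra $L$ of type $G_2$ has a Chevalley basis $\{h_a,h_b\}\cup\{e_r: r\in\Phi\}$, where $[h_r,h_s]=0$, $[h_r,e_s]=\frac{2(r,s)}{(r,r)}e_s$, $[e_r,e_{-r}]=h_r$ (with $h_r$ the coroot element of $r$, an integer combination of $h_a,h_b$), $[e_r,e_s]=N_{r,s}e_{r+s}$ if $r,s,r+s\in\Phi$, and $[e_r,e_s]=0$ if $r+s\notin\Phi\cup\{0\}$. For a Chevalley basis $N_{-r,-s}=-N_{r,s}$ and $N_{r,s}=\pm(p+1)$ when $r,s,r+s\in\Phi$, where $p$ is the largest integer with $s-pr\in\Phi$. In particular each $\epsilon_i\in\{1,-1\}$, and $\epsilon_i$ is regarded as an element of $K$ where needed. Chevalley group: let $L_{\mathbb{Z}}$ be the $\mathbb{Z}$-span of the Chevalley basis and $L_K=K\otimes_{\mathbb{Z}}L_{\mathbb{Z}}$. The maps $\frac{1}{k!}(\mathrm{ad}\,e_r)^k$ preserve $L_{\mathbb{Z}}$,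 and $x_r(t)=\exp(t\,\mathrm{ad}\,e_r)=\sum_{k\ge 0}t^k\frac{(\mathrm{ad}\,e_r)^k}{k!}$ is the resulting automorphism of $L_K$. Automorphisms act on the left and products are compositions. The Chevalley group of type $G_2$ over $K$ is generated by all $x_r(t)$. *)

theory Defs
  imports "HOL-Analysis.Analysis" "HOL-Algebra.Algebra"
begin

section \<open>The root system of type \<open>G\<^sub>2\<close>\<close>

text \<open>In \<open>real^3\<close> the numeral index \<open>3\<close> denotes the same element as \<open>0\<close>; the indices
  \<open>1, 2, 3\<close> are distinct.\<close>

definition G2_a :: "real^3" where
  "G2_a = axis 1 1 - axis 2 1"

definition G2_b :: "real^3" where
  "G2_b = - 2 *\<^sub>R axis 1 1 + axis 2 1 + axis 3 1"

definition G2_roots :: "(real^3) set" where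
  "G2_roots = (let a = G2_a; b = G2_b;
       P = {a, b, a + b, 2 *\<^sub>R a + b, 3 *\<^sub>R a + b, 3 *\<^sub>R a + 2 *\<^sub>R b} in P \<union> uminus ` P)"

definition coroot :: "real^3 \<Rightarrow> real^3" where
  "coroot r = (2 / (r \<bullet> r)) *\<^sub>R r"

definition string_down :: "real^3 \<Rightarrow> real^3 \<Rightarrow> int" where
  "string_down r s = Max {p::int. s - of_int p *\<^sub>R r \<in> G2_roots}"


section \<open>Complex Lie algebras and Chevalley bases of type \<open>G\<^sub>2\<close>\<close>

locale complex_lie_algebra = vector_space cscale
  for cscale :: "complex \<Rightarrow> 'l::ab_group_add \<Rightarrow> 'l" +
  fixes bracket :: "'l \<Rightarrow> 'l \<Rightarrow> 'l"
  assumes bracket_add_left: "bracket (x + y) z = bracket x z + bracket y z"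
    and bracket_add_right: "bracket x (y + z) = bracket x y + bracket x z"
    and bracket_scale_left: "bracket (cscale c x) y = cscale c (bracket x y)"
    and bracket_scale_right: "bracket x (cscale c y) = cscale c (bracket x y)"
    and bracket_self: "bracket x x = 0"
    and jacobi: "bracket x (bracket y z) + bracket y (bracket z x) + bracket z (bracket x y) = 0"
begin

definition lie_ideal :: "'l set \<Rightarrow> bool" where
  "lie_ideal I \<longleftrightarrow> subspace I \<and> (\<forall>x. \<forall>y\<in>I. bracket x y \<in> I)"

definition simple_lie_algebra :: bool where
  "simple_lie_algebra \<longleftrightarrow>
     (\<exists>x y. bracket x y \<noteq> 0) \<and> (\<forall>I. lie_ideal I \<longrightarrow> I = {0} \<or> I = UNIV)"

end

text \<open>
  The element \<open>h r\<close> is the coroot element of the root \<open>r\<close>, and \<open>N r s\<close> is the structure constant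
  \<open>N\<^sub>r\<^sub>,\<^sub>s\<close>. The values of \<open>h\<close>, \<open>e\<close> and \<open>N\<close> on other arguments are irrelevant. The assumption
  \<open>h_coroot\<close> says that \<open>h\<close> is additive on coroots: if \<open>coroot r\<close> is the integer combination of
  \<open>coroot a\<close> and \<open>coroot b\<close> with coefficients \<open>m\<close> and \<open>n\<close>, then \<open>h r\<close> is the same combination
  of \<open>h a\<close> and \<open>h b\<close>.
\<close>

locale G2_chevalley_basis = complex_lie_algebra cscale bracket
  for cscale :: "complex \<Rightarrow> 'l::ab_group_add \<Rightarrow> 'l"
    and bracket :: "'l \<Rightarrow> 'l \<Rightarrow> 'l" +
  fixes h e :: "real^3 \<Rightarrow> 'l"
    and N :: "real^3 \<Rightarrow> real^3 \<Rightarrow> int"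
  assumes simple: "simple_lie_algebra"
    and basis_distinct: "h G2_a \<noteq> h G2_b" "inj_on e G2_roots" "{h G2_a, h G2_b} \<inter> e ` G2_roots = {}"
    and basis_independent: "independent ({h G2_a, h G2_b} \<union> e ` G2_roots)"
    and basis_span: "span ({h G2_a, h G2_b} \<union> e ` G2_roots) = UNIV"
    and h_coroot: "\<And>r m n. \<lbrakk>r \<in> G2_roots;
        coroot r = of_int m *\<^sub>R coroot G2_a + of_int n *\<^sub>R coroot G2_b\<rbrakk>
        \<Longrightarrow> h r = cscale (of_int m) (h G2_a) + cscale (of_int n) (h G2_b)"
    and bracket_h_h: "\<And>r s. \<lbrakk>r \<in> G2_roots; s \<in> G2_roots\<rbrakk> \<Longrightarrow> bracket (h r) (h s) = 0"
    and bracket_h_e: "\<And>r s. \<lbrakk>r \<in> G2_roots; s \<in> G2_roots\<rbrakk>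
        \<Longrightarrow> bracket (h r) (e s) = cscale (of_real (2 * (r \<bullet> s) / (r \<bullet> r))) (e s)"
    and bracket_e_neg: "\<And>r. r \<in> G2_roots \<Longrightarrow> bracket (e r) (e (- r)) = h r"
    and bracket_e_e: "\<And>r s. \<lbrakk>r \<in> G2_roots; s \<in> G2_roots; r + s \<in> G2_roots\<rbrakk>
        \<Longrightarrow> bracket (e r) (e s) = cscale (of_int (N r s)) (e (r + s))"
    and bracket_e_e_zero: "\<And>r s. \<lbrakk>r \<in> G2_roots; s \<in> G2_roots; r + s \<notin> G2_roots \<union> {0}\<rbrakk>
        \<Longrightarrow> bracket (e r) (e s) = 0"
    and N_neg: "\<And>r s. \<lbrakk>r \<in> G2_roots; s \<in> G2_roots; r + s \<in> G2_roots\<rbrakk>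
        \<Longrightarrow> N (- r) (- s) = - N r s"
    and N_abs: "\<And>r s. \<lbrakk>r \<in> G2_roots; s \<in> G2_roots; r + s \<in> G2_roots\<rbrakk>
        \<Longrightarrow> N r s = string_down r s + 1 \<or> N r s = - (string_down r s + 1)"


section \<open>The tensor product \<open>K \<otimes>\<^sub>\<int> M\<close>\<close>

text \<open>
  For an additive subgroup \<open>M\<close> of the type \<open>'l\<close>, the tensor product over the integers of the whole
  type \<open>'k\<close> with \<open>M\<close> is the free abelian group on the pairs \<open>(c, v)\<close> with \<open>v \<in> M\<close>, modulo the
  biadditivity relations. The pure tensor of \<open>c\<close> and \<open>v\<close> is the coset of \<open>frag_of (c, v)\<close>.
\<close>

type_synonym ('k, 'l) tensor = "('k \<times> 'l \<Rightarrow>\<^sub>0 int) set"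

definition formal_tensors :: "'l set \<Rightarrow> ('k \<times> 'l \<Rightarrow>\<^sub>0 int) monoid" where
  "formal_tensors M = free_Abelian_group (UNIV \<times> M)"

definition tensor_relators :: "'l::ab_group_add set \<Rightarrow> ('k::ab_group_add \<times> 'l \<Rightarrow>\<^sub>0 int) set" where
  "tensor_relators M =
     {frag_of (c + d, v) - frag_of (c, v) - frag_of (d, v) | c d v. v \<in> M} \<union>
     {frag_of (c, v + w) - frag_of (c, v) - frag_of (c, w) | c v w. v \<in> M \<and> w \<in> M}"

definition tensor_null :: "'l::ab_group_add set \<Rightarrow> ('k::ab_group_add \<times> 'l \<Rightarrow>\<^sub>0 int) set" where
  "tensor_null M = generate (formal_tensors M) (tensor_relators M)"

definition tensor_product :: "'l::ab_group_add set \<Rightarrow> ('k::ab_group_add, 'l) tensor monoid" where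
  "tensor_product M = formal_tensors M Mod tensor_null M"


section \<open>The Chevalley group of type \<open>G\<^sub>2\<close>\<close>

definition chevalley_lattice ::
    "(complex \<Rightarrow> 'l::ab_group_add \<Rightarrow> 'l) \<Rightarrow> (real^3 \<Rightarrow> 'l) \<Rightarrow> (real^3 \<Rightarrow> 'l) \<Rightarrow> 'l set" where
  "chevalley_lattice cscale h e =
     module.span (\<lambda>n::int. cscale (of_int n)) ({h G2_a, h G2_b} \<union> e ` G2_roots)"

definition ad_divided_power ::
    "(complex \<Rightarrow> 'l \<Rightarrow> 'l) \<Rightarrow> ('l \<Rightarrow> 'l \<Rightarrow> 'l) \<Rightarrow> 'l \<Rightarrow> nat \<Rightarrow> 'l \<Rightarrow> 'l" where
  "ad_divided_power cscale bracket y k v = cscale (1 / fact k) ((bracket y ^^ k) v)"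

text \<open>
  The map \<open>exp (t ad y)\<close> on formal tensors, sending \<open>(c, v)\<close> to the sum over \<open>k\<close> of the pairs
  \<open>(t^k c, (ad y)^k v / k!)\<close>. The sum runs over the \<open>k\<close> with \<open>(ad y)^k \<noteq> 0\<close>, which are finitely
  many for \<open>y = e r\<close>.
\<close>

definition exp_ad_formal ::
    "(complex \<Rightarrow> 'l::zero \<Rightarrow> 'l) \<Rightarrow> ('l \<Rightarrow> 'l \<Rightarrow> 'l) \<Rightarrow> 'l \<Rightarrow> 'k::comm_ring_1
      \<Rightarrow> ('k \<times> 'l \<Rightarrow>\<^sub>0 int) \<Rightarrow> ('k \<times> 'l \<Rightarrow>\<^sub>0 int)" where
  "exp_ad_formal cscale bracket y t =
     frag_extend (\<lambda>(c, v). \<Sum>k | (bracket y ^^ k) \<noteq> (\<lambda>_. 0).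
       frag_of (t ^ k * c, ad_divided_power cscale bracket y k v))"

text \<open>
  The map induced on the quotient: a coset is sent to the coset of the image of any of its
  representatives; this does not depend on the choice.
\<close>

definition G2_root_element ::
    "(complex \<Rightarrow> 'l::ab_group_add \<Rightarrow> 'l) \<Rightarrow> ('l \<Rightarrow> 'l \<Rightarrow> 'l) \<Rightarrow> (real^3 \<Rightarrow> 'l) \<Rightarrow> (real^3 \<Rightarrow> 'l)
      \<Rightarrow> real^3 \<Rightarrow> 'k::comm_ring_1 \<Rightarrow> ('k, 'l) tensor \<Rightarrow> ('k, 'l) tensor" where
  "G2_root_element cscale bracket h e r t =
     (let M = chevalley_lattice cscale h e in
      (\<lambda>T \<in> carrier (tensor_product M).
        the_elem ((\<lambda>z. tensor_null M #>\<^bsub>formal_tensors M\<^esub> exp_ad_formal cscale bracket (e r) t z) ` T)))"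

text \<open>
  The group is a subgroup of the group \<open>BijGroup\<close> of all bijections of \<open>K \<otimes> L\<^sub>\<int>\<close>, in which the
  product of \<open>f\<close> and \<open>g\<close> is the composition that applies \<open>g\<close> first.
\<close>

definition G2_chevalley_group ::
    "(complex \<Rightarrow> 'l::ab_group_add \<Rightarrow> 'l) \<Rightarrow> ('l \<Rightarrow> 'l \<Rightarrow> 'l) \<Rightarrow> (real^3 \<Rightarrow> 'l) \<Rightarrow> (real^3 \<Rightarrow> 'l)
      \<Rightarrow> (('k::comm_ring_1, 'l) tensor \<Rightarrow> ('k, 'l) tensor) monoid" where
  "G2_chevalley_group cscale bracket h e =
     subgroup_generated (BijGroup (carrier (tensor_product (chevalley_lattice cscale h e))))
       {G2_root_element cscale bracket h e r t | r t. r \<in> G2_roots}"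

definition commutator :: "('g, 'm) monoid_scheme \<Rightarrow> 'g \<Rightarrow> 'g \<Rightarrow> 'g" where
  "commutator G x y = inv\<^bsub>G\<^esub> x \<otimes>\<^bsub>G\<^esub> inv\<^bsub>G\<^esub> y \<otimes>\<^bsub>G\<^esub> x \<otimes>\<^bsub>G\<^esub> y"

end

theory Submission
  imports Defs
begin

text \<open>
  Since \<open>G2_roots\<close> is invariant under its Weyl group, any pair \<open>(r, s)\<close> of roots with the Gram
  matrix of \<open>(a, b)\<close> can replace \<open>(a, b)\<close>, with new signs computed from the full table of structure
  constants, which the Jacobi identity determines from the four given ones. There are twelve such
  pairs, and each of the formulas becomes, for one of them, one of five formulas between positive
  roots. For those, the divided powers of \<open>ad e\<^sub>\<rho>\<close> give an explicit action of \<open>x\<^sub>\<rho>(t)\<close> on the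
  fourteen coordinates of \<open>K \<otimes> L\<^sub>\<int>\<close>. As \<open>[x, y] = z\<close> means \<open>x y = y x z\<close>, each of them is an
  identity between polynomial maps of the coordinates, valid over every commutative ring.
\<close>

section \<open>Tensor products over the integers\<close>

text \<open>The Weyl group enters without any conjugation inside the Chevalley group. The locale
  \<open>G2_base\<close> reads one and the same Chevalley basis from an arbitrary pair (r, s),
  keeping its four signs as symbols, so that a single computation with the roots i r + j s serves
  all twelve pairs. Six root elements suffice: when \<alpha> + \<beta> is a root, \<alpha> and
  \<beta> lie in an open half-plane, and so do all roots i \<alpha> + j \<beta> with nonnegative i
  and j that are not both 0. Tensors are cosets in a free abelian group, and a root element works
  through representatives. Coordinates bridge this gap: every tensor is the class of some
  \<open>vec c\<close>, and a group element is determined by its values on these classes. An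
  identity between the maps \<open>X_i_j\<close> on fourteen ring elements therefore yields an
  identity in the group.\<close>

definition tensor_class ::
    "'l::ab_group_add set \<Rightarrow> ('k::ab_group_add \<times> 'l \<Rightarrow>\<^sub>0 int) \<Rightarrow> ('k, 'l) tensor" where
  "tensor_class M z = tensor_null M #>\<^bsub>formal_tensors M\<^esub> z"

abbreviation pure_tensor ::
    "'l::ab_group_add set \<Rightarrow> 'k::ab_group_add \<Rightarrow> 'l \<Rightarrow> ('k, 'l) tensor" where
  "pure_tensor M c v \<equiv> tensor_class M (frag_of (c, v))"

locale additive_subgroup =
  fixes M :: "'l::ab_group_add set"
  assumes zero_mem: "0 \<in> M"
    and add_mem: "v \<in> M \<Longrightarrow> w \<in> M \<Longrightarrow> v + w \<in> M"
begin

lemma carrier_formal_tensors: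
  "z \<in> carrier (formal_tensors M) \<longleftrightarrow> Poly_Mapping.keys z \<subseteq> UNIV \<times> M"
  by (simp add: formal_tensors_def)

lemma mult_formal_tensors: "z \<otimes>\<^bsub>formal_tensors M\<^esub> w = z + w"
  by (simp add: formal_tensors_def)

lemma group_formal_tensors: "group (formal_tensors M)"
  by (simp add: formal_tensors_def)

lemma frag_of_carrier: "v \<in> M \<Longrightarrow> frag_of (c, v) \<in> carrier (formal_tensors M)"
  by (simp add: carrier_formal_tensors)

lemma carrier_add:
  "z \<in> carrier (formal_tensors M) \<Longrightarrow> w \<in> carrier (formal_tensors M)
    \<Longrightarrow> z + w \<in> carrier (formal_tensors M)"
  using monoid.m_closed[OF group.is_monoid[OF group_formal_tensors]]
  by (metis mult_formal_tensors)

lemma carrier_uminus: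
  "z \<in> carrier (formal_tensors M) \<Longrightarrow> - z \<in> carrier (formal_tensors M)"
  by (simp add: carrier_formal_tensors)

lemma carrier_diff:
  "z \<in> carrier (formal_tensors M) \<Longrightarrow> w \<in> carrier (formal_tensors M)
    \<Longrightarrow> z - w \<in> carrier (formal_tensors M)"
  using carrier_add[OF _ carrier_uminus, of z w] by simp

lemma relators_carrier: "tensor_relators M \<subseteq> carrier (formal_tensors M)"
  unfolding tensor_relators_def
  by (auto intro!: carrier_diff frag_of_carrier add_mem)

lemma subgroup_null: "subgroup (tensor_null M) (formal_tensors M)"
  unfolding tensor_null_def
  by (rule group.generate_is_subgroup[OF group_formal_tensors relators_carrier])

lemma null_carrier: "z \<in> tensor_null M \<Longrightarrow> z \<in> carrier (formal_tensors M)"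
  using subgroup.subset[OF subgroup_null] by blast

lemma null_zero: "0 \<in> tensor_null M"
  using subgroup.one_closed[OF subgroup_null] by (simp add: formal_tensors_def)

lemma null_add: "z \<in> tensor_null M \<Longrightarrow> w \<in> tensor_null M \<Longrightarrow> z + w \<in> tensor_null M"
  using subgroup.m_closed[OF subgroup_null] by (simp add: formal_tensors_def)

lemma null_uminus: "z \<in> tensor_null M \<Longrightarrow> - z \<in> tensor_null M"
  using subgroup.m_inv_closed[OF subgroup_null, of z] null_carrier[of z]
  by (simp add: formal_tensors_def)

lemma null_diff: "z \<in> tensor_null M \<Longrightarrow> w \<in> tensor_null M \<Longrightarrow> z - w \<in> tensor_null M"
  using null_add[OF _ null_uminus, of z w] by simp

lemma null_sum: "(\<And>k. k \<in> A \<Longrightarrow> f k \<in> tensor_null M) \<Longrightarrow> (\<Sum>k\<in>A. f k) \<in> tensor_null M"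
  by (induction A rule: infinite_finite_induct) (auto intro: null_zero null_add)

lemma tensor_class_eq_image: "tensor_class M z = (\<lambda>n. n + z) ` tensor_null M"
  by (auto simp: tensor_class_def r_coset_def mult_formal_tensors)

lemma tensor_class_eq_iff: "tensor_class M z = tensor_class M w \<longleftrightarrow> z - w \<in> tensor_null M"
proof
  assume "tensor_class M z = tensor_class M w"
  moreover have "z \<in> tensor_class M z"
    unfolding tensor_class_eq_image using null_zero by force
  ultimately obtain n where "n \<in> tensor_null M" "z = n + w"
    unfolding tensor_class_eq_image by blast
  then show "z - w \<in> tensor_null M" by simp
next
  assume d: "z - w \<in> tensor_null M"
  have "n + z \<in> (\<lambda>n. n + w) ` tensor_null M" if "n \<in> tensor_null M" for n
    using null_add[OF that d] by (intro image_eqI[of _ _ "n + (z - w)"]) (auto simp: algebra_simps)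
  moreover have "n + w \<in> (\<lambda>n. n + z) ` tensor_null M" if "n \<in> tensor_null M" for n
    using null_diff[OF that d] by (intro image_eqI[of _ _ "n - (z - w)"]) (auto simp: algebra_simps)
  ultimately show "tensor_class M z = tensor_class M w"
    unfolding tensor_class_eq_image by blast
qed

text \<open>The sum of two cosets below is their elementwise sum.\<close>

lemma tensor_class_add: "tensor_class M (z + w) = tensor_class M z + tensor_class M w"
proof -
  have "n + (z + w) \<in> tensor_class M z + tensor_class M w" if "n \<in> tensor_null M" for n
    using that null_zero unfolding tensor_class_eq_image set_plus_def
    by (force simp: algebra_simps intro: bexI[of _ n])
  moreover have "(m + z) + (n + w) \<in> tensor_class M (z + w)"
    if "m \<in> tensor_null M" "n \<in> tensor_null M" for m n
    using null_add[OF that] unfolding tensor_class_eq_image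
    by (intro image_eqI[of _ _ "m + n"]) (auto simp: algebra_simps)
  ultimately show ?thesis
    unfolding tensor_class_eq_image set_plus_def by blast
qed

text \<open>For elementwise addition of arbitrary sets the neutral element is \<open>{0}\<close>;
  the null coset is neutral only for cosets. The third equation removes it at the head of a
  right-nested sum, whose tail \<open>T\<close> is just a set.\<close>

lemma tensor_class_zero_add: "tensor_class M 0 + tensor_class M z = tensor_class M z"
  "tensor_class M z + tensor_class M 0 = tensor_class M z"
  "tensor_class M 0 + (tensor_class M z + T) = tensor_class M z + T"
  by (simp_all flip: tensor_class_add add.assoc)

lemma carrier_tensor_product:
  "carrier (tensor_product M) = tensor_class M ` carrier (formal_tensors M)"
  by (auto simp: tensor_product_def FactGroup_def RCOSETS_def tensor_class_def)

lemma pure_tensor_add_left: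
  assumes "v \<in> M"
  shows "pure_tensor M (c + d) v = pure_tensor M c v + pure_tensor M d v"
proof -
  have "frag_of (c + d, v) - frag_of (c, v) - frag_of (d, v) \<in> tensor_null M"
    unfolding tensor_null_def using assms
    by (intro generate.incl) (auto simp: tensor_relators_def)
  then show ?thesis
    by (simp add: tensor_class_eq_iff diff_diff_eq flip: tensor_class_add)
qed

lemma pure_tensor_add_right:
  assumes "v \<in> M" "w \<in> M"
  shows "pure_tensor M c (v + w) = pure_tensor M c v + pure_tensor M c w"
proof -
  have "frag_of (c, v + w) - frag_of (c, v) - frag_of (c, w) \<in> tensor_null M"
    unfolding tensor_null_def using assms
    by (intro generate.incl) (auto simp: tensor_relators_def)
  then show ?thesis
    by (simp add: tensor_class_eq_iff diff_diff_eq flip: tensor_class_add)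
qed

lemma tensor_class_add_cancel:
  "tensor_class M z + tensor_class M w = tensor_class M z \<longleftrightarrow> tensor_class M w = tensor_class M 0"
  by (simp add: tensor_class_eq_iff flip: tensor_class_add)

lemma pure_tensor_zero_left: "v \<in> M \<Longrightarrow> pure_tensor M 0 v = tensor_class M 0"
  using pure_tensor_add_left[of v 0 0] by (metis add_0 tensor_class_add_cancel)

lemma pure_tensor_zero_right: "pure_tensor M c 0 = tensor_class M 0"
  using pure_tensor_add_right[OF zero_mem zero_mem, of c] by (metis add_0 tensor_class_add_cancel)

text \<open>Differences instead of sums, because formal tensors also have negative coefficients.
  Membership in the carrier is carried through the induction, so that it is available for both
  operands of a difference.\<close>

lemma carrier_induct [consumes 1, case_names zero pure diff]:
  assumes z: "z \<in> carrier (formal_tensors M)"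
    and zero: "P 0" and pure: "\<And>c v. v \<in> M \<Longrightarrow> P (frag_of (c, v))"
    and diff: "\<And>z w. z \<in> carrier (formal_tensors M) \<Longrightarrow> w \<in> carrier (formal_tensors M) \<Longrightarrow>
      P z \<Longrightarrow> P w \<Longrightarrow> P (z - w)"
  shows "P z"
proof -
  have "Poly_Mapping.keys z \<subseteq> UNIV \<times> M \<and> P z"
    using z unfolding carrier_formal_tensors
  proof (induction z rule: frag_induction)
    case (diff a b)
    then show ?case using assms(4)[of a b] keys_diff[of a b] by (auto simp: carrier_formal_tensors)
  qed (auto simp: zero pure)
  then show ?thesis by blast
qed

end

section \<open>Endomorphisms of the tensor product from a family of additive maps\<close>

locale divided_power_family = additive_subgroup M for M :: "'l::ab_group_add set" +
  fixes D :: "nat \<Rightarrow> 'l \<Rightarrow> 'l" and A :: "nat set"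
  assumes D_mem: "v \<in> M \<Longrightarrow> D k v \<in> M"
    and D_add: "v \<in> M \<Longrightarrow> w \<in> M \<Longrightarrow> D k (v + w) = D k v + D k w"
begin

definition formal_exp :: "'k::comm_ring_1 \<Rightarrow> ('k \<times> 'l \<Rightarrow>\<^sub>0 int) \<Rightarrow> ('k \<times> 'l \<Rightarrow>\<^sub>0 int)" where
  "formal_exp t = frag_extend (\<lambda>(c, v). \<Sum>k\<in>A. frag_of (t ^ k * c, D k v))"

lemma formal_exp_frag_of:
  "formal_exp t (frag_of (c, v)) = (\<Sum>k\<in>A. frag_of (t ^ k * c, D k v))"
  by (simp add: formal_exp_def)

lemma formal_exp_zero: "formal_exp t 0 = 0"
  by (simp add: formal_exp_def)

lemma formal_exp_add: "formal_exp t (z + w) = formal_exp t z + formal_exp t w"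
  by (simp add: formal_exp_def frag_extend_add)

lemma formal_exp_diff: "formal_exp t (z - w) = formal_exp t z - formal_exp t w"
  by (simp add: formal_exp_def frag_extend_diff)

text \<open>The exponential descends to the tensor product because each map
  \<open>(c, v) \<mapsto> (t ^ k * c, D k v)\<close> is additive in both arguments: a relator goes
  to a sum of relators, one for each order k. The fact \<open>*\<close> serves both the generators
  and their inverses.\<close>

lemma formal_exp_null: "z \<in> tensor_null M \<Longrightarrow> formal_exp t z \<in> tensor_null M"
proof -
  assume "z \<in> tensor_null M"
  then have "z \<in> generate (formal_tensors M) (tensor_relators M)"
    by (simp add: tensor_null_def)
  then show ?thesis
  proof induction
    case one
    then show ?case by (simp add: formal_tensors_def formal_exp_zero null_zero)
  next
    have *: "formal_exp t z \<in> tensor_null M" if "z \<in> tensor_relators M" for z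
    proof -
      have 1: "frag_of (t ^ k * (c + d), D k v) - frag_of (t ^ k * c, D k v)
          - frag_of (t ^ k * d, D k v) \<in> tensor_null M" if "v \<in> M" for c d v k
        using pure_tensor_add_left[OF D_mem[OF that], where c="t ^ k * c" and d="t ^ k * d"]
        by (simp add: tensor_class_eq_iff diff_diff_eq ring_distribs flip: tensor_class_add)
      have 2: "frag_of (t ^ k * c, D k (v + w)) - frag_of (t ^ k * c, D k v)
          - frag_of (t ^ k * c, D k w) \<in> tensor_null M" if "v \<in> M" "w \<in> M" for c v w k
        using pure_tensor_add_right[OF D_mem[OF that(1)] D_mem[OF that(2)], where c="t ^ k * c"]
        by (simp add: tensor_class_eq_iff diff_diff_eq D_add that flip: tensor_class_add)
      show ?thesis
        using that unfolding tensor_relators_def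
        by (auto simp: formal_exp_diff formal_exp_frag_of simp flip: sum_subtractf
            intro!: null_sum 1 2)
    qed
    {
      case (incl z)
      then show ?case by (rule *)
    next
      case (inv z)
      moreover have "z \<in> carrier (formal_tensors M)"
        using inv relators_carrier by blast
      ultimately show ?case
        using null_uminus[OF *[OF inv]] formal_exp_diff[of t 0 z]
        by (simp add: formal_tensors_def formal_exp_zero)
    }
  next
    case (eng z w)
    then show ?case by (simp add: mult_formal_tensors formal_exp_add null_add)
  qed
qed

lemma formal_exp_class_cong:
  "tensor_class M z = tensor_class M w \<Longrightarrow>
    tensor_class M (formal_exp t z) = tensor_class M (formal_exp t w)"
  using formal_exp_null[of "z - w" t] by (simp add: tensor_class_eq_iff formal_exp_diff)

definition exp_class :: "'k::comm_ring_1 \<Rightarrow> ('k, 'l) tensor \<Rightarrow> ('k, 'l) tensor" where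
  "exp_class t = (\<lambda>T \<in> carrier (tensor_product M).
     the_elem ((\<lambda>z. tensor_class M (formal_exp t z)) ` T))"

text \<open>\<open>the_elem\<close> is meaningful here because the image of a coset consists of one
  class: two representatives differ by a null element, and \<open>formal_exp\<close> keeps such
  elements null.\<close>

lemma exp_class_tensor_class:
  assumes "z \<in> carrier (formal_tensors M)"
  shows "exp_class t (tensor_class M z) = tensor_class M (formal_exp t z)"
proof -
  have "(\<lambda>z. tensor_class M (formal_exp t z)) ` tensor_class M z = {tensor_class M (formal_exp t
      z)}"
  proof -
    have "tensor_class M (formal_exp t w) = tensor_class M (formal_exp t z)"
      if w: "w \<in> tensor_class M z" for w
    proof -
      obtain n where "n \<in> tensor_null M" "w = n + z"
        using w unfolding tensor_class_eq_image by blast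
      then show ?thesis by (intro formal_exp_class_cong) (simp add: tensor_class_eq_iff)
    qed
    moreover have "z \<in> tensor_class M z"
      unfolding tensor_class_eq_image using null_zero by force
    ultimately show ?thesis by blast
  qed
  then show ?thesis
    using assms by (simp add: exp_class_def carrier_tensor_product)
qed

end

section \<open>Structure constants\<close>

lemma G2_inner: "G2_a \<bullet> G2_a = 2" "G2_b \<bullet> G2_b = 6" "G2_a \<bullet> G2_b = - 3" "G2_b \<bullet> G2_a = - 3"
  by (simp_all add: G2_a_def G2_b_def inner_add_left inner_add_right inner_diff_left
      inner_diff_right inner_axis_axis)

section \<open>Roots and coroots in integer coordinates\<close>

definition root_comb :: "real^3 \<Rightarrow> real^3 \<Rightarrow> int \<Rightarrow> int \<Rightarrow> real^3" where
  "root_comb r s i j = of_int i *\<^sub>R r + of_int j *\<^sub>R s"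

lemma root_comb_add: "root_comb r s i j + root_comb r s k l = root_comb r s (i + k) (j + l)"
  by (simp add: root_comb_def scaleR_add_left)

lemma root_comb_uminus: "- root_comb r s i j = root_comb r s (- i) (- j)"
  by (simp add: root_comb_def)

lemma root_comb_comb:
  "root_comb (root_comb r s i j) (root_comb r s k l) m n = root_comb r s (m * i + n * k) (m * j +
      n * l)"
  by (simp add: root_comb_def algebra_simps)

definition G2_coeffs :: "(int \<times> int) set" where
  "G2_coeffs = {(1, 0), (0, 1), (1, 1), (2, 1), (3, 1), (3, 2),
     (- 1, 0), (0, - 1), (- 1, - 1), (- 2, - 1), (- 3, - 1), (- 3, - 2)}"

lemma G2_roots_coeffs: "G2_roots = (\<lambda>(i, j). root_comb G2_a G2_b i j) ` G2_coeffs"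
proof -
  have "root_comb G2_a G2_b 1 0 = G2_a" "root_comb G2_a G2_b 0 1 = G2_b"
    "root_comb G2_a G2_b 1 1 = G2_a + G2_b" "root_comb G2_a G2_b 2 1 = 2 *\<^sub>R G2_a + G2_b"
    "root_comb G2_a G2_b 3 1 = 3 *\<^sub>R G2_a + G2_b"
    "root_comb G2_a G2_b 3 2 = 3 *\<^sub>R G2_a + 2 *\<^sub>R G2_b"
    "root_comb G2_a G2_b (- i) (- j) = - root_comb G2_a G2_b i j"
    "root_comb G2_a G2_b (- i) 0 = - root_comb G2_a G2_b i 0"
    "root_comb G2_a G2_b 0 (- j) = - root_comb G2_a G2_b 0 j" for i j
    by (simp_all add: root_comb_def)
  then show ?thesis
    unfolding G2_roots_def G2_coeffs_def Let_def
    by (subst Un_commute) (simp del: minus_add_distrib)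
qed

lemma G2_roots_uminus: "p \<in> G2_roots \<Longrightarrow> - p \<in> G2_roots"
  by (auto simp: G2_roots_def Let_def)

lemma G2_root_norm: "p \<in> G2_roots \<Longrightarrow> p \<bullet> p = 2 \<or> p \<bullet> p = 6"
  by (auto simp: G2_roots_def Let_def inner_add_left inner_add_right inner_diff_left
      inner_diff_right G2_inner)

lemma G2_root_nonzero: "p \<in> G2_roots \<Longrightarrow> p \<noteq> 0"
  using G2_root_norm by fastforce

text \<open>The coroot of a is a, and that of b is b/3. Hence i a + j b of norm l has a coroot with
  coefficients 2i/l and 6j/l, and l divides both numerators for each of the twelve roots.\<close>

lemma coroot_integral:
  assumes "p \<in> G2_roots"
  obtains m n :: int where "coroot p = of_int m *\<^sub>R coroot G2_a + of_int n *\<^sub>R coroot G2_b"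
proof -
  have "\<exists>m n :: int. coroot p = of_int m *\<^sub>R coroot G2_a + of_int n *\<^sub>R coroot G2_b"
  proof -
    obtain i j where ij: "(i, j) \<in> G2_coeffs" and p: "p = root_comb G2_a G2_b i j"
      using assms unfolding G2_roots_coeffs by auto
    define l where "l = (2 * i * i + 6 * j * j - 6 * i * j)"
    have l: "p \<bullet> p = of_int l"
      unfolding p l_def root_comb_def
      by (simp add: inner_add_left inner_add_right G2_inner algebra_simps)
    have "l dvd 2 * i" "l dvd 6 * j"
      using ij by (auto simp: G2_coeffs_def l_def)
    then have "real_of_int (2 * i div l) = 2 * of_int i / of_int l"
      "real_of_int (6 * j div l) = 6 * of_int j / of_int l"
      by (simp_all add: real_of_int_div)
    then have "coroot p = of_int (2 * i div l) *\<^sub>R coroot G2_a + of_int (6 * j div l) *\<^sub>R coroot G2_b"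
      unfolding coroot_def l by (simp add: p root_comb_def G2_inner scaleR_add_right)
    then show ?thesis by blast
  qed
  then show ?thesis using that by blast
qed

section \<open>Relations between structure constants, and between coroot elements\<close>

context G2_chevalley_basis
begin

lemma e_nonzero: "p \<in> G2_roots \<Longrightarrow> e p \<noteq> 0"
  using basis_independent dependent_zero by (metis UnI2 image_eqI)

lemma cscale_e_cancel: "p \<in> G2_roots \<Longrightarrow> cscale c (e p) = cscale d (e p) \<longleftrightarrow> c = d"
  using e_nonzero by (simp add: scale_cancel_right)

lemma bracket_zero_left: "bracket 0 y = 0"
  using bracket_scale_left[of 0 0 y] by simp

lemma bracket_zero_right: "bracket x 0 = 0"
  using bracket_scale_right[of x 0 0] by simp

lemma bracket_anticommute: "bracket x y = - bracket y x"
proof -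
  have "bracket x y + bracket y x = bracket (x + y) (x + y)"
    unfolding bracket_add_left bracket_add_right by (simp add: bracket_self)
  then show ?thesis by (metis bracket_self eq_neg_iff_add_eq_0)
qed

lemma bracket_minus_right: "bracket x (- y) = - bracket x y"
  using bracket_scale_right[of x "- 1" y] by simp

lemma bracket_e_h:
  "p \<in> G2_roots \<Longrightarrow> q \<in> G2_roots \<Longrightarrow>
    bracket (e p) (h q) = cscale (of_real (- (2 * (q \<bullet> p) / (q \<bullet> q)))) (e p)"
  by (simp add: bracket_anticommute[of "e p"] bracket_h_e)

lemma N_antisym:
  assumes "p \<in> G2_roots" "q \<in> G2_roots" "p + q \<in> G2_roots"
  shows "N q p = - N p q"
proof -
  have "cscale (of_int (N q p)) (e (p + q)) = bracket (e q) (e p)"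
    using bracket_e_e[of q p] assms by (simp add: add.commute)
  also have "\<dots> = cscale (of_int (- N p q)) (e (p + q))"
    using bracket_anticommute[of "e q"] bracket_e_e[of p q] assms by simp
  finally show ?thesis
    using assms(3) by (simp only: cscale_e_cancel of_int_eq_iff)
qed

text \<open>The Jacobi identity for three roots with sum \<open>0\<close> yields a linear relation between their
  coroots; as any two of them are independent, the coefficients are proportional.\<close>

lemma N_cycle:
  assumes p: "p \<in> G2_roots" and q: "q \<in> G2_roots" and pq: "p + q \<in> G2_roots"
    and ind: "(p \<bullet> q)\<^sup>2 \<noteq> (p \<bullet> p) * (q \<bullet> q)"
  defines "w \<equiv> - (p + q)"
  shows "of_int (N q w) * (w \<bullet> w) = of_int (N p q) * (p \<bullet> p)"
    and "of_int (N w p) * (w \<bullet> w) = of_int (N p q) * (q \<bullet> q)"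
proof -
  have w: "w \<in> G2_roots" using G2_roots_uminus[OF pq] by (simp add: w_def)
  have sums: "q + w = - p" "w + p = - q" "p + q = - w" by (auto simp: w_def)
  have "bracket (e q) (e w) = cscale (of_int (N q w)) (e (- p))"
    "bracket (e w) (e p) = cscale (of_int (N w p)) (e (- q))"
    "bracket (e p) (e q) = cscale (of_int (N p q)) (e (- w))"
    using bracket_e_e[OF q w] bracket_e_e[OF w p] bracket_e_e[OF p q] p q w sums
    by (auto simp: G2_roots_uminus)
  with jacobi[of "e p" "e q" "e w"]
  have rel: "cscale (of_int (N q w)) (h p) + cscale (of_int (N w p)) (h q)
      + cscale (of_int (N p q)) (h w) = 0"
    by (simp add: bracket_scale_right bracket_e_neg p q w)
  \<comment> \<open>Since \<open>h p\<close> acts on \<open>e x\<close> by 2(p,x)/(p,p), dividing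
    each coefficient by the norm of its root turns the relation into one between the inner products
    of p, q and w with x.\<close>
  define A where "A = of_int (N q w) / (p \<bullet> p)"
  define B where "B = of_int (N w p) / (q \<bullet> q)"
  define C where "C = of_int (N p q) / (w \<bullet> w)"
  have lin: "A * (p \<bullet> x) + B * (q \<bullet> x) + C * (w \<bullet> x) = 0" if x: "x \<in> G2_roots" for x
  proof -
    have "bracket (cscale (of_int (N q w)) (h p) + cscale (of_int (N w p)) (h q)
      + cscale (of_int (N p q)) (h w)) (e x) = 0"
      by (simp add: rel bracket_zero_left)
    then have "cscale (of_real (2 * (A * (p \<bullet> x) + B * (q \<bullet> x) + C * (w \<bullet> x)))) (e x) = cscale 0
        (e x)"
      by (simp add: bracket_add_left bracket_scale_left bracket_h_e p q w x A_def B_def C_def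
          algebra_simps flip: scale_left_distrib)
    then have "of_real (2 * (A * (p \<bullet> x) + B * (q \<bullet> x) + C * (w \<bullet> x))) = (0 :: complex)"
      using x by (simp only: cscale_e_cancel)
    then show ?thesis
      by (simp only: of_real_eq_0_iff mult_eq_0_iff) simp
  qed
  have 1: "(A - C) * (p \<bullet> p) + (B - C) * (p \<bullet> q) = 0"
    using lin[OF p] by (simp add: w_def inner_add_left inner_commute algebra_simps)
  have 2: "(A - C) * (p \<bullet> q) + (B - C) * (q \<bullet> q) = 0"
    using lin[OF q] by (simp add: w_def inner_add_left inner_commute algebra_simps)
  \<comment> \<open>Elimination in the two equations above; the factor on the left is their Gram
    determinant, which \<open>ind\<close> makes nonzero.\<close>
  have "(A - C) * ((p \<bullet> p) * (q \<bullet> q) - (p \<bullet> q)\<^sup>2)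
      = (q \<bullet> q) * ((A - C) * (p \<bullet> p) + (B - C) * (p \<bullet> q))
        - (p \<bullet> q) * ((A - C) * (p \<bullet> q) + (B - C) * (q \<bullet> q))"
    by (simp add: algebra_simps power2_eq_square)
  with ind 1 2 have AC: "A = C" by simp
  with 2 G2_root_nonzero[OF q] have BC: "B = C" by simp
  from AC BC show "of_int (N q w) * (w \<bullet> w) = of_int (N p q) * (p \<bullet> p)"
    and "of_int (N w p) * (w \<bullet> w) = of_int (N p q) * (q \<bullet> q)"
    using G2_root_nonzero[OF p] G2_root_nonzero[OF q] G2_root_nonzero[OF w]
    by (simp_all add: A_def B_def C_def field_simps)
qed

text \<open>One constant fixes twelve: the roots p, q, w with sum 0 can be permuted cyclically,
  transposed and negated. The values \<open>m\<close> and \<open>m'\<close> come with their norm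
  relations in multiplied form, so that every instance is decided by integer arithmetic.\<close>

lemma N_triple:
  assumes p: "p \<in> G2_roots" and q: "q \<in> G2_roots" and pq: "p + q \<in> G2_roots"
    and ind: "(p \<bullet> q)\<^sup>2 \<noteq> (p \<bullet> p) * (q \<bullet> q)"
    and w: "w = - (p + q)" and n: "N p q = n"
    and m: "of_int m * (w \<bullet> w) = of_int n * (p \<bullet> p)"
    and m': "of_int m' * (w \<bullet> w) = of_int n * (q \<bullet> q)"
  shows "N p q = n" "N q w = m" "N w p = m'" "N q p = - n" "N w q = - m" "N p w = - m'"
    "N (- p) (- q) = - n" "N (- q) (- w) = - m" "N (- w) (- p) = - m'"
    "N (- q) (- p) = n" "N (- w) (- q) = m" "N (- p) (- w) = m'"
proof -
  have wr: "w \<in> G2_roots" using G2_roots_uminus[OF pq] w by simp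
  have sums: "q + w \<in> G2_roots" "w + q \<in> G2_roots" "w + p \<in> G2_roots" "p + w \<in> G2_roots"
      "q + p \<in> G2_roots"
    using G2_roots_uminus[OF p] G2_roots_uminus[OF q] pq w by (simp_all add: add.commute)
  show 1: "N p q = n" by (rule n)
  have ww: "w \<bullet> w \<noteq> 0" using G2_root_nonzero[OF wr] by simp
  have "of_int (N q w) * (w \<bullet> w) = of_int m * (w \<bullet> w)"
    "of_int (N w p) * (w \<bullet> w) = of_int m' * (w \<bullet> w)"
    using N_cycle[OF p q pq ind, folded w] m m' n by simp_all
  with ww show 2: "N q w = m" and 3: "N w p = m'" by simp_all
  show 4: "N q p = - n" and 5: "N w q = - m" and 6: "N p w = - m'"
    using N_antisym[OF p q pq] N_antisym[OF q wr sums(1)] N_antisym[OF wr p sums(3)] 1 2 3 by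
        simp_all
  show "N (- p) (- q) = - n" "N (- q) (- w) = - m" "N (- w) (- p) = - m'"
    "N (- q) (- p) = n" "N (- w) (- q) = m" "N (- p) (- w) = m'"
    using N_neg[OF p q pq] N_neg[OF q wr sums(1)] N_neg[OF wr p sums(3)]
      N_neg[OF q p sums(5)] N_neg[OF wr q sums(2)] N_neg[OF p wr sums(4)] 1 2 3 4 5 6 by simp_all
qed

text \<open>\<open>h_coroot\<close> refers only to the coroots of \<open>G2_a\<close> and
  \<open>G2_b\<close>. Expanding the coroots of p and q in these extends the additivity to any two
  roots, as a change of base requires.\<close>

lemma h_comb:
  assumes "p \<in> G2_roots" "q \<in> G2_roots" "w \<in> G2_roots"
    and w: "coroot w = of_int m *\<^sub>R coroot p + of_int n *\<^sub>R coroot q"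
  shows "h w = cscale (of_int m) (h p) + cscale (of_int n) (h q)"
proof -
  obtain i j where p: "coroot p = of_int i *\<^sub>R coroot G2_a + of_int j *\<^sub>R coroot G2_b"
    using coroot_integral[OF assms(1)] .
  obtain k l where q: "coroot q = of_int k *\<^sub>R coroot G2_a + of_int l *\<^sub>R coroot G2_b"
    using coroot_integral[OF assms(2)] .
  have "coroot w = of_int (m * i + n * k) *\<^sub>R coroot G2_a + of_int (m * j + n * l) *\<^sub>R coroot G2_b"
    unfolding w p q by (simp add: algebra_simps)
  from h_coroot[OF assms(3) this] h_coroot[OF assms(1) p] h_coroot[OF assms(2) q]
  show ?thesis by (simp add: algebra_simps)
qed

end

section \<open>Bases of the root system\<close>

text \<open>Roots are addressed as \<open>root_comb r s i j\<close>, which turns questions about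
  vectors into arithmetic with (i, j). The signs are constrained through their squares, the form in
  which they cancel in products over any ring. For the pair (a, b) these properties come from
  \<open>N_abs\<close>, for the other pairs from the table of structure constants.\<close>

locale G2_base = G2_chevalley_basis cscale bracket h e N
  for cscale :: "complex \<Rightarrow> 'l::ab_group_add \<Rightarrow> 'l" and bracket h e N +
  fixes r s :: "real^3" and \<epsilon>\<^sub>1 \<epsilon>\<^sub>2 \<epsilon>\<^sub>3 \<epsilon>\<^sub>4 :: int
  assumes inner_base: "r \<bullet> r = 2" "s \<bullet> s = 6" "r \<bullet> s = - 3"
    and roots_eq: "G2_roots = (\<lambda>(i, j). root_comb r s i j) ` G2_coeffs"
    and N_base: "N (root_comb r s 1 0) (root_comb r s 0 1) = \<epsilon>\<^sub>1"
      "N (root_comb r s 1 0) (root_comb r s 1 1) = 2 * \<epsilon>\<^sub>2"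
      "N (root_comb r s 1 0) (root_comb r s 2 1) = 3 * \<epsilon>\<^sub>3"
      "N (root_comb r s 0 1) (root_comb r s 3 1) = \<epsilon>\<^sub>4"
    and sign: "\<epsilon>\<^sub>1 * \<epsilon>\<^sub>1 = 1" "\<epsilon>\<^sub>2 * \<epsilon>\<^sub>2 = 1" "\<epsilon>\<^sub>3 * \<epsilon>\<^sub>3 = 1" "\<epsilon>\<^sub>4 * \<epsilon>\<^sub>4 = 1"
begin

abbreviation rt :: "int \<Rightarrow> int \<Rightarrow> real^3" where
  "rt \<equiv> root_comb r s"

lemma inner_rt: "rt i j \<bullet> rt k l = of_int (2 * i * k + 6 * j * l - 3 * (i * l + j * k))"
proof -
  have "s \<bullet> r = - 3" using inner_base(3) by (simp add: inner_commute)
  with inner_base show ?thesis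
    by (simp add: root_comb_def inner_add_left inner_add_right algebra_simps)
qed

text \<open>Pairing with r and s gives 2i = 3j and i = 2j, a system with the nonzero Gram
  determinant of r and s.\<close>

lemma rt_eq_0_iff: "rt i j = 0 \<longleftrightarrow> i = 0 \<and> j = 0"
proof
  assume "rt i j = 0"
  with inner_rt[of i j 1 0] inner_rt[of i j 0 1]
  have "real_of_int (2 * i - 3 * j) = 0" "real_of_int (6 * j - 3 * i) = 0"
    by (simp_all add: algebra_simps)
  then have "2 * i - 3 * j = 0" "6 * j - 3 * i = 0" by linarith+
  then show "i = 0 \<and> j = 0" by simp
qed (simp add: root_comb_def)

lemma rt_eq_iff: "rt i j = rt k l \<longleftrightarrow> i = k \<and> j = l"
proof -
  have "rt i j - rt k l = rt (i - k) (j - l)"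
    by (simp add: root_comb_def algebra_simps)
  then show ?thesis using rt_eq_0_iff[of "i - k" "j - l"] by auto
qed

lemma rt_mem_iff: "rt i j \<in> G2_roots \<longleftrightarrow> (i, j) \<in> G2_coeffs"
  unfolding roots_eq by (auto simp: rt_eq_iff)

lemmas rt_calc = rt_mem_iff G2_coeffs_def root_comb_add root_comb_uminus inner_rt

text \<open>Up to negation there are five triples of roots with sum 0. Each of the tables 1 to 5
  belongs to one of them, and together they list all sixty ordered pairs of roots whose sum is a
  root. The coefficients 3 come from the quotient of a long by a short norm.\<close>

lemma N_table_1:
  "N (rt 1 0) (rt 0 1) = \<epsilon>\<^sub>1"
  "N (rt 0 1) (rt (- 1) (- 1)) = \<epsilon>\<^sub>1"
  "N (rt (- 1) (- 1)) (rt 1 0) = 3 * \<epsilon>\<^sub>1"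
  "N (rt 0 1) (rt 1 0) = - \<epsilon>\<^sub>1"
  "N (rt (- 1) (- 1)) (rt 0 1) = - \<epsilon>\<^sub>1"
  "N (rt 1 0) (rt (- 1) (- 1)) = - 3 * \<epsilon>\<^sub>1"
  "N (rt (- 1) 0) (rt 0 (- 1)) = - \<epsilon>\<^sub>1"
  "N (rt 0 (- 1)) (rt 1 1) = - \<epsilon>\<^sub>1"
  "N (rt 1 1) (rt (- 1) 0) = - 3 * \<epsilon>\<^sub>1"
  "N (rt 0 (- 1)) (rt (- 1) 0) = \<epsilon>\<^sub>1"
  "N (rt 1 1) (rt 0 (- 1)) = \<epsilon>\<^sub>1"
  "N (rt (- 1) 0) (rt 1 1) = 3 * \<epsilon>\<^sub>1"
  using N_triple[of "rt 1 0" "rt 0 1" "rt (- 1) (- 1)" "\<epsilon>\<^sub>1" "\<epsilon>\<^sub>1" "3 * \<epsilon>\<^sub>1"] N_base(1)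
  by (simp_all add: rt_calc)

lemma N_table_2:
  "N (rt 1 0) (rt 1 1) = 2 * \<epsilon>\<^sub>2"
  "N (rt 1 1) (rt (- 2) (- 1)) = 2 * \<epsilon>\<^sub>2"
  "N (rt (- 2) (- 1)) (rt 1 0) = 2 * \<epsilon>\<^sub>2"
  "N (rt 1 1) (rt 1 0) = - 2 * \<epsilon>\<^sub>2"
  "N (rt (- 2) (- 1)) (rt 1 1) = - 2 * \<epsilon>\<^sub>2"
  "N (rt 1 0) (rt (- 2) (- 1)) = - 2 * \<epsilon>\<^sub>2"
  "N (rt (- 1) 0) (rt (- 1) (- 1)) = - 2 * \<epsilon>\<^sub>2"
  "N (rt (- 1) (- 1)) (rt 2 1) = - 2 * \<epsilon>\<^sub>2"
  "N (rt 2 1) (rt (- 1) 0) = - 2 * \<epsilon>\<^sub>2"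
  "N (rt (- 1) (- 1)) (rt (- 1) 0) = 2 * \<epsilon>\<^sub>2"
  "N (rt 2 1) (rt (- 1) (- 1)) = 2 * \<epsilon>\<^sub>2"
  "N (rt (- 1) 0) (rt 2 1) = 2 * \<epsilon>\<^sub>2"
  using N_triple[of "rt 1 0" "rt 1 1" "rt (- 2) (- 1)" "2 * \<epsilon>\<^sub>2" "2 * \<epsilon>\<^sub>2" "2 * \<epsilon>\<^sub>2"] N_base(2)
  by (simp_all add: rt_calc)

lemma N_table_3:
  "N (rt 1 0) (rt 2 1) = 3 * \<epsilon>\<^sub>3"
  "N (rt 2 1) (rt (- 3) (- 1)) = \<epsilon>\<^sub>3"
  "N (rt (- 3) (- 1)) (rt 1 0) = \<epsilon>\<^sub>3"
  "N (rt 2 1) (rt 1 0) = - 3 * \<epsilon>\<^sub>3"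
  "N (rt (- 3) (- 1)) (rt 2 1) = - \<epsilon>\<^sub>3"
  "N (rt 1 0) (rt (- 3) (- 1)) = - \<epsilon>\<^sub>3"
  "N (rt (- 1) 0) (rt (- 2) (- 1)) = - 3 * \<epsilon>\<^sub>3"
  "N (rt (- 2) (- 1)) (rt 3 1) = - \<epsilon>\<^sub>3"
  "N (rt 3 1) (rt (- 1) 0) = - \<epsilon>\<^sub>3"
  "N (rt (- 2) (- 1)) (rt (- 1) 0) = 3 * \<epsilon>\<^sub>3"
  "N (rt 3 1) (rt (- 2) (- 1)) = \<epsilon>\<^sub>3"
  "N (rt (- 1) 0) (rt 3 1) = \<epsilon>\<^sub>3"
  using N_triple[of "rt 1 0" "rt 2 1" "rt (- 3) (- 1)" "3 * \<epsilon>\<^sub>3" "\<epsilon>\<^sub>3" "\<epsilon>\<^sub>3"] N_base(3)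
  by (simp_all add: rt_calc)

lemma N_table_4:
  "N (rt 0 1) (rt 3 1) = \<epsilon>\<^sub>4"
  "N (rt 3 1) (rt (- 3) (- 2)) = \<epsilon>\<^sub>4"
  "N (rt (- 3) (- 2)) (rt 0 1) = \<epsilon>\<^sub>4"
  "N (rt 3 1) (rt 0 1) = - \<epsilon>\<^sub>4"
  "N (rt (- 3) (- 2)) (rt 3 1) = - \<epsilon>\<^sub>4"
  "N (rt 0 1) (rt (- 3) (- 2)) = - \<epsilon>\<^sub>4"
  "N (rt 0 (- 1)) (rt (- 3) (- 1)) = - \<epsilon>\<^sub>4"
  "N (rt (- 3) (- 1)) (rt 3 2) = - \<epsilon>\<^sub>4"
  "N (rt 3 2) (rt 0 (- 1)) = - \<epsilon>\<^sub>4"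
  "N (rt (- 3) (- 1)) (rt 0 (- 1)) = \<epsilon>\<^sub>4"
  "N (rt 3 2) (rt (- 3) (- 1)) = \<epsilon>\<^sub>4"
  "N (rt 0 (- 1)) (rt 3 2) = \<epsilon>\<^sub>4"
  using N_triple[of "rt 0 1" "rt 3 1" "rt (- 3) (- 2)" "\<epsilon>\<^sub>4" "\<epsilon>\<^sub>4" "\<epsilon>\<^sub>4"] N_base(4)
  by (simp_all add: rt_calc)

lemma bracket_rt:
  assumes "(i, j) \<in> G2_coeffs" "(k, l) \<in> G2_coeffs"
  shows "bracket (e (rt i j)) (e (rt k l)) =
    (if i + k = 0 \<and> j + l = 0 then h (rt i j)
     else if (i + k, j + l) \<in> G2_coeffs
       then cscale (of_int (N (rt i j) (rt k l))) (e (rt (i + k) (j + l))) else 0)"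
proof -
  have "rt k l = - rt i j" if "i + k = 0 \<and> j + l = 0"
    using that by (simp add: root_comb_uminus rt_eq_iff)
  then show ?thesis
    using assms bracket_e_neg[of "rt i j"] bracket_e_e[of "rt i j" "rt k l"]
      bracket_e_e_zero[of "rt i j" "rt k l"]
    by (auto simp: rt_mem_iff root_comb_add rt_eq_0_iff)
qed

text \<open>The origin of the fifth sign. In the Jacobi identity for r, s and 2r + s the term with
  [e_s, e_(2r+s)] vanishes because 2r + 2s is not a root; the other two give
  \<open>\<epsilon>\<^sub>1 * N (rt 2 1) (rt 1 1) = 3 * \<epsilon>\<^sub>3 *
  \<epsilon>\<^sub>4\<close>.\<close>

lemma N_5: "N (rt 2 1) (rt 1 1) = 3 * \<epsilon>\<^sub>1 * \<epsilon>\<^sub>3 * \<epsilon>\<^sub>4"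
proof -
  have "cscale (of_int (\<epsilon>\<^sub>1 * N (rt 2 1) (rt 1 1) - 3 * \<epsilon>\<^sub>3 * \<epsilon>\<^sub>4)) (e (rt 3 2)) = cscale (of_int 0)
      (e (rt 3 2))"
  using jacobi[of "e (rt 1 0)" "e (rt 0 1)" "e (rt 2 1)"]
    by (simp add: bracket_rt G2_coeffs_def N_table_1 N_table_2 N_table_3 N_table_4
        bracket_scale_right bracket_zero_right bracket_minus_right algebra_simps)
  then have "\<epsilon>\<^sub>1 * N (rt 2 1) (rt 1 1) = 3 * \<epsilon>\<^sub>3 * \<epsilon>\<^sub>4"
    by (simp add: e_nonzero rt_mem_iff G2_coeffs_def del: of_int_mult of_int_diff)
  then have "\<epsilon>\<^sub>1 * \<epsilon>\<^sub>1 * N (rt 2 1) (rt 1 1) = \<epsilon>\<^sub>1 * (3 * \<epsilon>\<^sub>3 * \<epsilon>\<^sub>4)"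
    by (simp add: mult.assoc)
  then show ?thesis by (simp add: sign algebra_simps)
qed

lemma N_table_5:
  "N (rt 2 1) (rt 1 1) = 3 * \<epsilon>\<^sub>1 * \<epsilon>\<^sub>3 * \<epsilon>\<^sub>4"
  "N (rt 1 1) (rt (- 3) (- 2)) = \<epsilon>\<^sub>1 * \<epsilon>\<^sub>3 * \<epsilon>\<^sub>4"
  "N (rt (- 3) (- 2)) (rt 2 1) = \<epsilon>\<^sub>1 * \<epsilon>\<^sub>3 * \<epsilon>\<^sub>4"
  "N (rt 1 1) (rt 2 1) = - 3 * \<epsilon>\<^sub>1 * \<epsilon>\<^sub>3 * \<epsilon>\<^sub>4"
  "N (rt (- 3) (- 2)) (rt 1 1) = - (\<epsilon>\<^sub>1 * \<epsilon>\<^sub>3 * \<epsilon>\<^sub>4)"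
  "N (rt 2 1) (rt (- 3) (- 2)) = - (\<epsilon>\<^sub>1 * \<epsilon>\<^sub>3 * \<epsilon>\<^sub>4)"
  "N (rt (- 2) (- 1)) (rt (- 1) (- 1)) = - 3 * \<epsilon>\<^sub>1 * \<epsilon>\<^sub>3 * \<epsilon>\<^sub>4"
  "N (rt (- 1) (- 1)) (rt 3 2) = - (\<epsilon>\<^sub>1 * \<epsilon>\<^sub>3 * \<epsilon>\<^sub>4)"
  "N (rt 3 2) (rt (- 2) (- 1)) = - (\<epsilon>\<^sub>1 * \<epsilon>\<^sub>3 * \<epsilon>\<^sub>4)"
  "N (rt (- 1) (- 1)) (rt (- 2) (- 1)) = 3 * \<epsilon>\<^sub>1 * \<epsilon>\<^sub>3 * \<epsilon>\<^sub>4"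
  "N (rt 3 2) (rt (- 1) (- 1)) = \<epsilon>\<^sub>1 * \<epsilon>\<^sub>3 * \<epsilon>\<^sub>4"
  "N (rt (- 2) (- 1)) (rt 3 2) = \<epsilon>\<^sub>1 * \<epsilon>\<^sub>3 * \<epsilon>\<^sub>4"
  using N_triple[of "rt 2 1" "rt 1 1" "rt (- 3) (- 2)" "3 * \<epsilon>\<^sub>1 * \<epsilon>\<^sub>3 * \<epsilon>\<^sub>4" "\<epsilon>\<^sub>1 * \<epsilon>\<^sub>3 * \<epsilon>\<^sub>4" "\<epsilon>\<^sub>1 * \<epsilon>\<^sub>3
      * \<epsilon>\<^sub>4"] N_5
  by (simp_all add: rt_calc)

lemmas N_table = N_table_1 N_table_2 N_table_3 N_table_4 N_table_5

lemma bracket_rt_h: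
  assumes "(i, j) \<in> G2_coeffs" "(k, l) \<in> G2_coeffs"
  shows "bracket (e (rt i j)) (h (rt k l)) =
    cscale (of_real (- (2 * (rt k l \<bullet> rt i j) / (rt k l \<bullet> rt k l)))) (e (rt i j))"
  using assms by (intro bracket_e_h) (simp_all add: rt_mem_iff)

text \<open>As in \<open>coroot_integral\<close>, the coefficients are 2i/l and 6j/l for the norm l,
  here relative to r and s and with denominators cleared for the table below.\<close>

lemma h_rt:
  assumes "(i, j) \<in> G2_coeffs" and "i * 2 = m * l" "j * 6 = n * l"
    and l: "l = 2 * i * i + 6 * j * j - 6 * i * j"
  shows "h (rt i j) = cscale (of_int m) (h (rt 1 0)) + cscale (of_int n) (h (rt 0 1))"
proof (rule h_comb)
  have l0: "rt i j \<bullet> rt i j = of_int l"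
    by (simp add: inner_rt l algebra_simps)
  then have "real_of_int l \<noteq> 0"
    using G2_root_nonzero[of "rt i j"] assms(1) by (auto simp: rt_mem_iff)
  have "real_of_int (i * 2) = of_int (m * l)" "real_of_int (j * 6) = of_int (n * l)"
    using assms(2,3) by simp_all
  then have "2 * of_int i / of_int l = real_of_int m" "2 * of_int j / of_int l = real_of_int n / 3"
    using \<open>real_of_int l \<noteq> 0\<close> by (simp_all add: field_simps)
  then have "coroot (rt i j) = real_of_int m *\<^sub>R r + (real_of_int n / 3) *\<^sub>R s"
    unfolding coroot_def l0 by (simp add: root_comb_def scaleR_add_right)
  then show "coroot (rt i j) = real_of_int m *\<^sub>R coroot (rt 1 0) + real_of_int n *\<^sub>R coroot (rt 0 1)"
    by (simp add: coroot_def inner_rt) (simp add: root_comb_def)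
qed (use assms in \<open>simp_all add: rt_mem_iff G2_coeffs_def\<close>)

lemma h_table:
  "h (rt 1 1) = cscale (of_int 1) (h (rt 1 0)) + cscale (of_int 3) (h (rt 0 1))"
  "h (rt 2 1) = cscale (of_int 2) (h (rt 1 0)) + cscale (of_int 3) (h (rt 0 1))"
  "h (rt 3 1) = cscale (of_int 1) (h (rt 1 0)) + cscale (of_int 1) (h (rt 0 1))"
  "h (rt 3 2) = cscale (of_int 1) (h (rt 1 0)) + cscale (of_int 2) (h (rt 0 1))"
  "h (rt (- 1) 0) = cscale (of_int (- 1)) (h (rt 1 0)) + cscale (of_int 0) (h (rt 0 1))"
  "h (rt 0 (- 1)) = cscale (of_int 0) (h (rt 1 0)) + cscale (of_int (- 1)) (h (rt 0 1))"
  "h (rt (- 1) (- 1)) = cscale (of_int (- 1)) (h (rt 1 0)) + cscale (of_int (- 3)) (h (rt 0 1))"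
  "h (rt (- 2) (- 1)) = cscale (of_int (- 2)) (h (rt 1 0)) + cscale (of_int (- 3)) (h (rt 0 1))"
  "h (rt (- 3) (- 1)) = cscale (of_int (- 1)) (h (rt 1 0)) + cscale (of_int (- 1)) (h (rt 0 1))"
  "h (rt (- 3) (- 2)) = cscale (of_int (- 1)) (h (rt 1 0)) + cscale (of_int (- 2)) (h (rt 0 1))"
  by (rule h_rt[OF _ _ _ refl]; simp add: G2_coeffs_def)+

section \<open>Divided powers of the adjoint action on the basis\<close>

abbreviation D :: "int \<Rightarrow> int \<Rightarrow> nat \<Rightarrow> 'l \<Rightarrow> 'l" where
  "D i j \<equiv> ad_divided_power cscale bracket (e (rt i j))"

lemma D_0: "D i j 0 v = v"
  and D_1: "D i j 1 v = bracket (e (rt i j)) v"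
  and D_2: "D i j 2 v = cscale (1 / 2) (bracket (e (rt i j)) (bracket (e (rt i j)) v))"
  and D_3: "D i j 3 v = cscale (1 / 6)
    (bracket (e (rt i j)) (bracket (e (rt i j)) (bracket (e (rt i j)) v)))"
  by (simp_all add: ad_divided_power_def numeral_eq_Suc)

text \<open>Carries the cancellation of signs to an arbitrary ring; the second form acts inside
  right-nested products.\<close>

lemma of_int_sign:
  fixes x :: "'a::ring_1"
  assumes "n * n = 1"
  shows "of_int n * of_int n = (1 :: 'a)" "of_int n * (of_int n * x) = x"
  using arg_cong[OF assms, of "of_int :: int \<Rightarrow> 'a"] by (simp_all flip: mult.assoc)

lemmas signs = sign[THEN of_int_sign(1)] sign[THEN of_int_sign(2)]

text \<open>The coroot elements of r + s and 3r + s have parts in \<open>h (rt 1 0)\<close> and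
  \<open>h (rt 0 1)\<close> that both act nontrivially on the respective root vector; the two
  multiples obtained have to be collected.\<close>

lemma diff_cscale: "v - cscale c v = cscale (1 - c) v"
  by (simp add: scale_left_diff_distrib)

lemmas D_simps = D_1[unfolded One_nat_def] D_1 D_2 D_3 bracket_rt bracket_rt_h G2_coeffs_def
  N_table h_table(1-4) inner_rt bracket_add_right bracket_scale_right bracket_zero_right
  bracket_minus_right scale_right_distrib diff_cscale signs mult.commute mult.left_commute

text \<open>All entries are integral: along a root string the absolute values of the constants
  increase by 1, so that a product of k of them contains k!. For example \<open>e (rt 0 1)\<close>
  meets the absolute values 1, 2, 3, whose partial products cancel 1!, 2!, 3!. On the string through
  0 the factor 2 of [e_r, h_r] = -2 e_r cancels 2!.\<close>

lemma D_table_1: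
  "map (\<lambda>k. D 1 0 k (h (rt 1 0))) [1, 2, 3] = [cscale (of_int (- 2)) (e (rt 1 0)), 0, 0]"
  "map (\<lambda>k. D 1 0 k (h (rt 0 1))) [1, 2, 3] = [cscale (of_int 1) (e (rt 1 0)), 0, 0]"
  "map (\<lambda>k. D 1 0 k (e (rt 1 0))) [1, 2, 3] = [0, 0, 0]"
  "map (\<lambda>k. D 1 0 k (e (rt 0 1))) [1, 2, 3] = [cscale (of_int \<epsilon>\<^sub>1) (e (rt 1 1)), cscale (of_int (\<epsilon>\<^sub>1
      * \<epsilon>\<^sub>2)) (e (rt 2 1)), cscale (of_int (\<epsilon>\<^sub>1 * \<epsilon>\<^sub>2 * \<epsilon>\<^sub>3)) (e (rt 3 1))]"
  "map (\<lambda>k. D 1 0 k (e (rt 1 1))) [1, 2, 3] = [cscale (of_int (2 * \<epsilon>\<^sub>2)) (e (rt 2 1)), cscale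
      (of_int (3 * \<epsilon>\<^sub>2 * \<epsilon>\<^sub>3)) (e (rt 3 1)), 0]"
  "map (\<lambda>k. D 1 0 k (e (rt 2 1))) [1, 2, 3] = [cscale (of_int (3 * \<epsilon>\<^sub>3)) (e (rt 3 1)), 0, 0]"
  "map (\<lambda>k. D 1 0 k (e (rt 3 1))) [1, 2, 3] = [0, 0, 0]"
  "map (\<lambda>k. D 1 0 k (e (rt 3 2))) [1, 2, 3] = [0, 0, 0]"
  "map (\<lambda>k. D 1 0 k (e (rt (- 1) 0))) [1, 2, 3] = [cscale (of_int 1) (h (rt 1 0)), cscale (of_int
      (- 1)) (e (rt 1 0)), 0]"
  "map (\<lambda>k. D 1 0 k (e (rt 0 (- 1)))) [1, 2, 3] = [0, 0, 0]"
  "map (\<lambda>k. D 1 0 k (e (rt (- 1) (- 1)))) [1, 2, 3] = [cscale (of_int (- 3 * \<epsilon>\<^sub>1)) (e (rt 0 (-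
      1))), 0, 0]"
  "map (\<lambda>k. D 1 0 k (e (rt (- 2) (- 1)))) [1, 2, 3] = [cscale (of_int (- 2 * \<epsilon>\<^sub>2)) (e (rt (- 1) (-
      1))), cscale (of_int (3 * \<epsilon>\<^sub>1 * \<epsilon>\<^sub>2)) (e (rt 0 (- 1))), 0]"
  "map (\<lambda>k. D 1 0 k (e (rt (- 3) (- 1)))) [1, 2, 3] = [cscale (of_int (- \<epsilon>\<^sub>3)) (e (rt (- 2) (-
      1))), cscale (of_int (\<epsilon>\<^sub>2 * \<epsilon>\<^sub>3)) (e (rt (- 1) (- 1))), cscale (of_int (- (\<epsilon>\<^sub>1 * \<epsilon>\<^sub>2 * \<epsilon>\<^sub>3))) (e
      (rt 0 (- 1)))]"
  "map (\<lambda>k. D 1 0 k (e (rt (- 3) (- 2)))) [1, 2, 3] = [0, 0, 0]"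
  by (simp_all add: D_simps) 

lemma D_table_2:
  "map (\<lambda>k. D 0 1 k (h (rt 1 0))) [1, 2, 3] = [cscale (of_int 3) (e (rt 0 1)), 0, 0]"
  "map (\<lambda>k. D 0 1 k (h (rt 0 1))) [1, 2, 3] = [cscale (of_int (- 2)) (e (rt 0 1)), 0, 0]"
  "map (\<lambda>k. D 0 1 k (e (rt 1 0))) [1, 2, 3] = [cscale (of_int (- \<epsilon>\<^sub>1)) (e (rt 1 1)), 0, 0]"
  "map (\<lambda>k. D 0 1 k (e (rt 0 1))) [1, 2, 3] = [0, 0, 0]"
  "map (\<lambda>k. D 0 1 k (e (rt 1 1))) [1, 2, 3] = [0, 0, 0]"
  "map (\<lambda>k. D 0 1 k (e (rt 2 1))) [1, 2, 3] = [0, 0, 0]"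
  "map (\<lambda>k. D 0 1 k (e (rt 3 1))) [1, 2, 3] = [cscale (of_int \<epsilon>\<^sub>4) (e (rt 3 2)), 0, 0]"
  "map (\<lambda>k. D 0 1 k (e (rt 3 2))) [1, 2, 3] = [0, 0, 0]"
  "map (\<lambda>k. D 0 1 k (e (rt (- 1) 0))) [1, 2, 3] = [0, 0, 0]"
  "map (\<lambda>k. D 0 1 k (e (rt 0 (- 1)))) [1, 2, 3] = [cscale (of_int 1) (h (rt 0 1)), cscale (of_int
      (- 1)) (e (rt 0 1)), 0]"
  "map (\<lambda>k. D 0 1 k (e (rt (- 1) (- 1)))) [1, 2, 3] = [cscale (of_int \<epsilon>\<^sub>1) (e (rt (- 1) 0)), 0, 0]"
  "map (\<lambda>k. D 0 1 k (e (rt (- 2) (- 1)))) [1, 2, 3] = [0, 0, 0]"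
  "map (\<lambda>k. D 0 1 k (e (rt (- 3) (- 1)))) [1, 2, 3] = [0, 0, 0]"
  "map (\<lambda>k. D 0 1 k (e (rt (- 3) (- 2)))) [1, 2, 3] = [cscale (of_int (- \<epsilon>\<^sub>4)) (e (rt (- 3) (-
      1))), 0, 0]"
  by (simp_all add: D_simps) 

lemma D_table_3:
  "map (\<lambda>k. D 1 1 k (h (rt 1 0))) [1, 2, 3] = [cscale (of_int 1) (e (rt 1 1)), 0, 0]"
  "map (\<lambda>k. D 1 1 k (h (rt 0 1))) [1, 2, 3] = [cscale (of_int (- 1)) (e (rt 1 1)), 0, 0]"
  "map (\<lambda>k. D 1 1 k (e (rt 1 0))) [1, 2, 3] = [cscale (of_int (- 2 * \<epsilon>\<^sub>2)) (e (rt 2 1)), cscale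
      (of_int (3 * \<epsilon>\<^sub>1 * \<epsilon>\<^sub>2 * \<epsilon>\<^sub>3 * \<epsilon>\<^sub>4)) (e (rt 3 2)), 0]"
  "map (\<lambda>k. D 1 1 k (e (rt 0 1))) [1, 2, 3] = [0, 0, 0]"
  "map (\<lambda>k. D 1 1 k (e (rt 1 1))) [1, 2, 3] = [0, 0, 0]"
  "map (\<lambda>k. D 1 1 k (e (rt 2 1))) [1, 2, 3] = [cscale (of_int (- 3 * \<epsilon>\<^sub>1 * \<epsilon>\<^sub>3 * \<epsilon>\<^sub>4)) (e (rt 3 2)),
      0, 0]"
  "map (\<lambda>k. D 1 1 k (e (rt 3 1))) [1, 2, 3] = [0, 0, 0]"
  "map (\<lambda>k. D 1 1 k (e (rt 3 2))) [1, 2, 3] = [0, 0, 0]"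
  "map (\<lambda>k. D 1 1 k (e (rt (- 1) 0))) [1, 2, 3] = [cscale (of_int (- 3 * \<epsilon>\<^sub>1)) (e (rt 0 1)), 0, 0]"
  "map (\<lambda>k. D 1 1 k (e (rt 0 (- 1)))) [1, 2, 3] = [cscale (of_int \<epsilon>\<^sub>1) (e (rt 1 0)), cscale (of_int
      (- (\<epsilon>\<^sub>1 * \<epsilon>\<^sub>2))) (e (rt 2 1)), cscale (of_int (\<epsilon>\<^sub>2 * \<epsilon>\<^sub>3 * \<epsilon>\<^sub>4)) (e (rt 3 2))]"
  "map (\<lambda>k. D 1 1 k (e (rt (- 1) (- 1)))) [1, 2, 3] = [cscale (of_int 1) (h (rt 1 0)) + cscale
      (of_int 3) (h (rt 0 1)), cscale (of_int (- 1)) (e (rt 1 1)), 0]"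
  "map (\<lambda>k. D 1 1 k (e (rt (- 2) (- 1)))) [1, 2, 3] = [cscale (of_int (2 * \<epsilon>\<^sub>2)) (e (rt (- 1) 0)),
      cscale (of_int (- 3 * \<epsilon>\<^sub>1 * \<epsilon>\<^sub>2)) (e (rt 0 1)), 0]"
  "map (\<lambda>k. D 1 1 k (e (rt (- 3) (- 1)))) [1, 2, 3] = [0, 0, 0]"
  "map (\<lambda>k. D 1 1 k (e (rt (- 3) (- 2)))) [1, 2, 3] = [cscale (of_int (\<epsilon>\<^sub>1 * \<epsilon>\<^sub>3 * \<epsilon>\<^sub>4)) (e (rt (- 2)
      (- 1))), cscale (of_int (\<epsilon>\<^sub>1 * \<epsilon>\<^sub>2 * \<epsilon>\<^sub>3 * \<epsilon>\<^sub>4)) (e (rt (- 1) 0)), cscale (of_int (- (\<epsilon>\<^sub>2 * \<epsilon>\<^sub>3 *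
      \<epsilon>\<^sub>4))) (e (rt 0 1))]"
  by (simp_all add: D_simps) 

lemma D_table_4:
  "map (\<lambda>k. D 2 1 k (h (rt 1 0))) [1, 2, 3] = [cscale (of_int (- 1)) (e (rt 2 1)), 0, 0]"
  "map (\<lambda>k. D 2 1 k (h (rt 0 1))) [1, 2, 3] = [0, 0, 0]"
  "map (\<lambda>k. D 2 1 k (e (rt 1 0))) [1, 2, 3] = [cscale (of_int (- 3 * \<epsilon>\<^sub>3)) (e (rt 3 1)), 0, 0]"
  "map (\<lambda>k. D 2 1 k (e (rt 0 1))) [1, 2, 3] = [0, 0, 0]"
  "map (\<lambda>k. D 2 1 k (e (rt 1 1))) [1, 2, 3] = [cscale (of_int (3 * \<epsilon>\<^sub>1 * \<epsilon>\<^sub>3 * \<epsilon>\<^sub>4)) (e (rt 3 2)), 0,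
      0]"
  "map (\<lambda>k. D 2 1 k (e (rt 2 1))) [1, 2, 3] = [0, 0, 0]"
  "map (\<lambda>k. D 2 1 k (e (rt 3 1))) [1, 2, 3] = [0, 0, 0]"
  "map (\<lambda>k. D 2 1 k (e (rt 3 2))) [1, 2, 3] = [0, 0, 0]"
  "map (\<lambda>k. D 2 1 k (e (rt (- 1) 0))) [1, 2, 3] = [cscale (of_int (- 2 * \<epsilon>\<^sub>2)) (e (rt 1 1)), cscale
      (of_int (- 3 * \<epsilon>\<^sub>1 * \<epsilon>\<^sub>2 * \<epsilon>\<^sub>3 * \<epsilon>\<^sub>4)) (e (rt 3 2)), 0]"
  "map (\<lambda>k. D 2 1 k (e (rt 0 (- 1)))) [1, 2, 3] = [0, 0, 0]"
  "map (\<lambda>k. D 2 1 k (e (rt (- 1) (- 1)))) [1, 2, 3] = [cscale (of_int (2 * \<epsilon>\<^sub>2)) (e (rt 1 0)),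
      cscale (of_int (- 3 * \<epsilon>\<^sub>2 * \<epsilon>\<^sub>3)) (e (rt 3 1)), 0]"
  "map (\<lambda>k. D 2 1 k (e (rt (- 2) (- 1)))) [1, 2, 3] = [cscale (of_int 2) (h (rt 1 0)) + cscale
      (of_int 3) (h (rt 0 1)), cscale (of_int (- 1)) (e (rt 2 1)), 0]"
  "map (\<lambda>k. D 2 1 k (e (rt (- 3) (- 1)))) [1, 2, 3] = [cscale (of_int \<epsilon>\<^sub>3) (e (rt (- 1) 0)), cscale
      (of_int (- (\<epsilon>\<^sub>2 * \<epsilon>\<^sub>3))) (e (rt 1 1)), cscale (of_int (- (\<epsilon>\<^sub>1 * \<epsilon>\<^sub>2 * \<epsilon>\<^sub>4))) (e (rt 3 2))]"
  "map (\<lambda>k. D 2 1 k (e (rt (- 3) (- 2)))) [1, 2, 3] = [cscale (of_int (- (\<epsilon>\<^sub>1 * \<epsilon>\<^sub>3 * \<epsilon>\<^sub>4))) (e (rt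
      (- 1) (- 1))), cscale (of_int (- (\<epsilon>\<^sub>1 * \<epsilon>\<^sub>2 * \<epsilon>\<^sub>3 * \<epsilon>\<^sub>4))) (e (rt 1 0)), cscale (of_int (\<epsilon>\<^sub>1 * \<epsilon>\<^sub>2
      * \<epsilon>\<^sub>4)) (e (rt 3 1))]"
  by (simp_all add: D_simps) 

lemma D_table_5:
  "map (\<lambda>k. D 3 1 k (h (rt 1 0))) [1, 2, 3] = [cscale (of_int (- 3)) (e (rt 3 1)), 0, 0]"
  "map (\<lambda>k. D 3 1 k (h (rt 0 1))) [1, 2, 3] = [cscale (of_int 1) (e (rt 3 1)), 0, 0]"
  "map (\<lambda>k. D 3 1 k (e (rt 1 0))) [1, 2, 3] = [0, 0, 0]"
  "map (\<lambda>k. D 3 1 k (e (rt 0 1))) [1, 2, 3] = [cscale (of_int (- \<epsilon>\<^sub>4)) (e (rt 3 2)), 0, 0]"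
  "map (\<lambda>k. D 3 1 k (e (rt 1 1))) [1, 2, 3] = [0, 0, 0]"
  "map (\<lambda>k. D 3 1 k (e (rt 2 1))) [1, 2, 3] = [0, 0, 0]"
  "map (\<lambda>k. D 3 1 k (e (rt 3 1))) [1, 2, 3] = [0, 0, 0]"
  "map (\<lambda>k. D 3 1 k (e (rt 3 2))) [1, 2, 3] = [0, 0, 0]"
  "map (\<lambda>k. D 3 1 k (e (rt (- 1) 0))) [1, 2, 3] = [cscale (of_int (- \<epsilon>\<^sub>3)) (e (rt 2 1)), 0, 0]"
  "map (\<lambda>k. D 3 1 k (e (rt 0 (- 1)))) [1, 2, 3] = [0, 0, 0]"
  "map (\<lambda>k. D 3 1 k (e (rt (- 1) (- 1)))) [1, 2, 3] = [0, 0, 0]"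
  "map (\<lambda>k. D 3 1 k (e (rt (- 2) (- 1)))) [1, 2, 3] = [cscale (of_int \<epsilon>\<^sub>3) (e (rt 1 0)), 0, 0]"
  "map (\<lambda>k. D 3 1 k (e (rt (- 3) (- 1)))) [1, 2, 3] = [cscale (of_int 1) (h (rt 1 0)) + cscale
      (of_int 1) (h (rt 0 1)), cscale (of_int (- 1)) (e (rt 3 1)), 0]"
  "map (\<lambda>k. D 3 1 k (e (rt (- 3) (- 2)))) [1, 2, 3] = [cscale (of_int \<epsilon>\<^sub>4) (e (rt 0 (- 1))), 0, 0]"
  by (simp_all add: D_simps) 

lemma D_table_6:
  "map (\<lambda>k. D 3 2 k (h (rt 1 0))) [1, 2, 3] = [0, 0, 0]"
  "map (\<lambda>k. D 3 2 k (h (rt 0 1))) [1, 2, 3] = [cscale (of_int (- 1)) (e (rt 3 2)), 0, 0]"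
  "map (\<lambda>k. D 3 2 k (e (rt 1 0))) [1, 2, 3] = [0, 0, 0]"
  "map (\<lambda>k. D 3 2 k (e (rt 0 1))) [1, 2, 3] = [0, 0, 0]"
  "map (\<lambda>k. D 3 2 k (e (rt 1 1))) [1, 2, 3] = [0, 0, 0]"
  "map (\<lambda>k. D 3 2 k (e (rt 2 1))) [1, 2, 3] = [0, 0, 0]"
  "map (\<lambda>k. D 3 2 k (e (rt 3 1))) [1, 2, 3] = [0, 0, 0]"
  "map (\<lambda>k. D 3 2 k (e (rt 3 2))) [1, 2, 3] = [0, 0, 0]"
  "map (\<lambda>k. D 3 2 k (e (rt (- 1) 0))) [1, 2, 3] = [0, 0, 0]"
  "map (\<lambda>k. D 3 2 k (e (rt 0 (- 1)))) [1, 2, 3] = [cscale (of_int (- \<epsilon>\<^sub>4)) (e (rt 3 1)), 0, 0]"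
  "map (\<lambda>k. D 3 2 k (e (rt (- 1) (- 1)))) [1, 2, 3] = [cscale (of_int (\<epsilon>\<^sub>1 * \<epsilon>\<^sub>3 * \<epsilon>\<^sub>4)) (e (rt 2
      1)), 0, 0]"
  "map (\<lambda>k. D 3 2 k (e (rt (- 2) (- 1)))) [1, 2, 3] = [cscale (of_int (- (\<epsilon>\<^sub>1 * \<epsilon>\<^sub>3 * \<epsilon>\<^sub>4))) (e (rt 1
      1)), 0, 0]"
  "map (\<lambda>k. D 3 2 k (e (rt (- 3) (- 1)))) [1, 2, 3] = [cscale (of_int \<epsilon>\<^sub>4) (e (rt 0 1)), 0, 0]"
  "map (\<lambda>k. D 3 2 k (e (rt (- 3) (- 2)))) [1, 2, 3] = [cscale (of_int 1) (h (rt 1 0)) + cscale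
      (of_int 2) (h (rt 0 1)), cscale (of_int (- 1)) (e (rt 3 2)), 0]"
  by (simp_all add: D_simps) 

end

section \<open>The lattice and the action of root elements in coordinates\<close>

context G2_chevalley_basis
begin

abbreviation lattice :: "'l set" where
  "lattice \<equiv> chevalley_lattice cscale h e"

lemma module_int: "Modules.module (\<lambda>n::int. cscale (of_int n))"
  by standard (simp_all add: scale_left_distrib scale_right_distrib)

lemma lattice_zero: "0 \<in> lattice"
  and lattice_add: "v \<in> lattice \<Longrightarrow> w \<in> lattice \<Longrightarrow> v + w \<in> lattice"
  and lattice_scale: "v \<in> lattice \<Longrightarrow> cscale (of_int n) v \<in> lattice"
  unfolding chevalley_lattice_def
  by (auto intro: Modules.module.span_zero[OF module_int] Modules.module.span_add[OF module_int]
      Modules.module.span_scale[OF module_int, where c = n])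

lemma lattice_e: "p \<in> G2_roots \<Longrightarrow> e p \<in> lattice"
  and lattice_h_a: "h G2_a \<in> lattice" and lattice_h_b: "h G2_b \<in> lattice"
  unfolding chevalley_lattice_def by (auto intro: Modules.module.span_base[OF module_int])

lemma lattice_h: assumes "p \<in> G2_roots" shows "h p \<in> lattice"
proof -
  obtain m n :: int where "coroot p = of_int m *\<^sub>R coroot G2_a + of_int n *\<^sub>R coroot G2_b"
    using coroot_integral[OF assms] .
  from h_coroot[OF assms this] show ?thesis
    by (auto intro: lattice_add lattice_scale lattice_h_a lattice_h_b)
qed

sublocale additive_subgroup lattice
  by standard (auto intro: lattice_zero lattice_add)

text \<open>The relators express biadditivity only; that integers move across the tensor sign
  follows by induction for naturals and then by negation.\<close>

lemma pure_tensor_scale: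
  fixes c :: "'k::comm_ring_1"
  assumes v: "v \<in> lattice"
  shows "pure_tensor lattice c (cscale (of_int n) v) = pure_tensor lattice (of_int n * c) v"
proof -
  have nat: "pure_tensor lattice c (cscale (of_nat k) v) = pure_tensor lattice (of_nat k * c) v"
    for k and c :: 'k
  proof (induction k)
    case 0
    then show ?case by (simp add: pure_tensor_zero_left pure_tensor_zero_right v)
  next
    case (Suc k)
    have "cscale (of_nat k) v \<in> lattice"
      using lattice_scale[OF v, of "int k"] by simp
    with Suc show ?case
      by (simp add: scale_left_distrib distrib_right pure_tensor_add_right pure_tensor_add_left v)
  qed
  have minus: "pure_tensor lattice c (- w) = pure_tensor lattice (- c) w"
    if w: "w \<in> lattice" for w and c :: 'k
  proof -
    have w': "- w \<in> lattice" using lattice_scale[OF w, of "- 1"] by simp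
    \<comment> \<open>The sum of the pure tensors of (c, -w), (c, w) and (-c, w) is bracketed in two
      ways: the last two cancel, and so do the first two.\<close>
    have "pure_tensor lattice c (- w) =
        pure_tensor lattice c (- w) + (pure_tensor lattice c w + pure_tensor lattice (- c) w)"
      by (simp add: pure_tensor_zero_left w tensor_class_zero_add flip: pure_tensor_add_left)
    also have "\<dots> = (pure_tensor lattice c (- w) + pure_tensor lattice c w) + pure_tensor lattice
        (- c) w"
      by (simp only: add.assoc)
    also have "\<dots> = pure_tensor lattice (- c) w"
      by (simp add: pure_tensor_zero_right w w' tensor_class_zero_add flip: pure_tensor_add_right)
    finally show ?thesis .
  qed
  show ?thesis
  proof (cases n)
    case (nonneg k)
    then show ?thesis using nat[of c k] by simp
  next
    case (neg k)
    have "cscale (of_nat (Suc k)) v \<in> lattice"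
      using lattice_scale[OF v, of "int (Suc k)"] by simp
    from minus[OF this, of c] nat[of "- c" "Suc k"] show ?thesis
      by (simp only: neg of_int_minus of_int_of_nat_eq scale_minus_left mult_minus_left
          mult_minus_right)
  qed
qed

lemma ad_divided_power_add:
  "ad_divided_power cscale bracket y k (v + w) =
    ad_divided_power cscale bracket y k v + ad_divided_power cscale bracket y k w"
proof -
  have "(bracket y ^^ k) (v + w) = (bracket y ^^ k) v + (bracket y ^^ k) w"
    by (induction k) (simp_all add: bracket_add_right)
  then show ?thesis by (simp add: ad_divided_power_def scale_right_distrib)
qed

lemma funpow_bracket_scale: "(bracket y ^^ k) (cscale c v) = cscale c ((bracket y ^^ k) v)"
  by (induction k) (simp_all add: bracket_scale_right)

lemma ad_divided_power_scale:
  "ad_divided_power cscale bracket y k (cscale c v) = cscale c (ad_divided_power cscale bracket y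
      k v)"
  by (simp add: ad_divided_power_def funpow_bracket_scale mult.commute)

lemma funpow_bracket_add: "(bracket y ^^ k) (v + w) = (bracket y ^^ k) v + (bracket y ^^ k) w"
  by (induction k) (simp_all add: bracket_add_right)

lemma funpow_bracket_zero: "(bracket y ^^ k) 0 = 0"
  by (induction k) (simp_all add: bracket_zero_right)

end

text \<open>Fourteen is the dimension of the Lie algebra. Injectivity of the single constructor
  splits an equation between coordinate maps into fourteen ring identities.\<close>

datatype 'k coords = Coords 'k 'k 'k 'k 'k 'k 'k 'k 'k 'k 'k 'k 'k 'k

context G2_base
begin

section \<open>Induction over the lattice and over the Lie algebra from the basis attached to (r,
  s)\<close>

lemma h_rt_combination:
  assumes "p \<in> G2_roots"
  obtains m n :: int where
    "h p = cscale (of_int m) (h (rt 1 0)) + cscale (of_int n) (h (rt 0 1))"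
proof -
  obtain i j where p: "p = rt i j" and ij: "(i, j) \<in> G2_coeffs"
    using assms unfolding roots_eq by auto
  have "\<exists>m n :: int. h (rt i j) = cscale (of_int m) (h (rt 1 0)) + cscale (of_int n) (h (rt 0 1))"
  proof (cases "(i, j) = (1, 0) \<or> (i, j) = (0, 1)")
    case True
    have "h (rt 1 0) = cscale (of_int 1) (h (rt 1 0)) + cscale (of_int 0) (h (rt 0 1))"
      "h (rt 0 1) = cscale (of_int 0) (h (rt 1 0)) + cscale (of_int 1) (h (rt 0 1))" by simp_all
    with True show ?thesis by blast
  next
    case False
    with ij show ?thesis unfolding G2_coeffs_def using h_table by blast
  qed
  then show ?thesis using that p by blast
qed

definition base_basis :: "'l set" where
  "base_basis = insert (h (rt 1 0)) (insert (h (rt 0 1)) ((\<lambda>(i, j). e (rt i j)) ` G2_coeffs))"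

lemma e_base_basis: "p \<in> G2_roots \<Longrightarrow> e p \<in> base_basis"
  by (auto simp: base_basis_def roots_eq)

text \<open>The lattice is defined by means of (a, b). As \<open>h G2_a\<close> and
  \<open>h G2_b\<close> are integral combinations of \<open>h (rt 1 0)\<close> and
  \<open>h (rt 0 1)\<close>, it suffices to check the generators that belong to the current
  pair.\<close>

lemma lattice_induct [consumes 1, case_names zero add scale basis]:
  assumes v: "v \<in> lattice" and zero: "P 0"
    and add: "\<And>v w. P v \<Longrightarrow> P w \<Longrightarrow> P (v + w)"
    and scale: "\<And>n v. P v \<Longrightarrow> P (cscale (of_int n) v)"
    and basis: "\<And>v. v \<in> base_basis \<Longrightarrow> P v"
  shows "P v"
proof -
  have h: "P (h p)" if "p \<in> G2_roots" for p
    using h_rt_combination[OF that] basis add scale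
    by (metis base_basis_def insertI1 insertI2)
  have ab: "G2_a \<in> G2_roots" "G2_b \<in> G2_roots" by (auto simp: G2_roots_def Let_def)
  have "Modules.module.subspace (\<lambda>n::int. cscale (of_int n)) {v. P v}"
    using zero add scale by (auto simp: Modules.module.subspace_def[OF module_int])
  moreover have "v \<in> Modules.module.span (\<lambda>n::int. cscale (of_int n)) ({h G2_a, h G2_b} \<union> e `
      G2_roots)"
    using v by (simp add: chevalley_lattice_def)
  ultimately show ?thesis
    using Modules.module.span_induct[OF module_int, of v _ P] h ab basis e_base_basis by blast
qed

text \<open>The complex counterpart of \<open>lattice_induct\<close>. It serves the nilpotency of
  the adjoint maps, which concerns all vectors: \<open>exp_ad_formal\<close> selects its orders by
  the vanishing of a power on the whole Lie algebra.\<close>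

lemma linear_induct [case_names zero add scale basis]:
  assumes zero: "P 0"
    and add: "\<And>v w. P v \<Longrightarrow> P w \<Longrightarrow> P (v + w)"
    and scale: "\<And>c v. P v \<Longrightarrow> P (cscale c v)"
    and basis: "\<And>v. v \<in> base_basis \<Longrightarrow> P v"
  shows "P v"
proof -
  have lat: "P v" if "v \<in> lattice" for v
    using that by (induction rule: lattice_induct) (auto intro: assms)
  have "subspace {v. P v}"
    using zero add scale by (auto simp: subspace_def)
  moreover have "v \<in> span ({h G2_a, h G2_b} \<union> e ` G2_roots)"
    using basis_span by simp
  ultimately show ?thesis
    using span_induct[of v _ P] lat lattice_e lattice_h_a lattice_h_b by blast
qed

lemma base_basis_cases:
  assumes "v \<in> base_basis"
    and "P (h (rt 1 0))" "P (h (rt 0 1))" "P (e (rt 1 0))" "P (e (rt 0 1))" "P (e (rt 1 1))" "P (e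
        (rt 2 1))" "P (e (rt 3 1))" "P (e (rt 3 2))" "P (e (rt (- 1) 0))" "P (e (rt 0 (- 1)))" "P
        (e (rt (- 1) (- 1)))" "P (e (rt (- 2) (- 1)))" "P (e (rt (- 3) (- 1)))" "P (e (rt (- 3) (-
        2)))"
  shows "P v"
  using assms unfolding base_basis_def G2_coeffs_def by auto

lemma base_basis_lattice:
  "h (rt 1 0) \<in> lattice"
  "h (rt 0 1) \<in> lattice"
  "e (rt 1 0) \<in> lattice"
  "e (rt 0 1) \<in> lattice"
  "e (rt 1 1) \<in> lattice"
  "e (rt 2 1) \<in> lattice"
  "e (rt 3 1) \<in> lattice"
  "e (rt 3 2) \<in> lattice"
  "e (rt (- 1) 0) \<in> lattice"
  "e (rt 0 (- 1)) \<in> lattice"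
  "e (rt (- 1) (- 1)) \<in> lattice"
  "e (rt (- 2) (- 1)) \<in> lattice"
  "e (rt (- 3) (- 1)) \<in> lattice"
  "e (rt (- 3) (- 2)) \<in> lattice"
  by (auto intro!: lattice_h lattice_e simp: rt_mem_iff G2_coeffs_def)

definition positive :: "(int \<times> int) set" where
  "positive = {(1, 0), (0, 1), (1, 1), (2, 1), (3, 1), (3, 2)}"

lemmas D_tables = D_table_1 D_table_2 D_table_3 D_table_4 D_table_5 D_table_6

lemmas D_values = D_tables[unfolded list.map list.inject]

lemma positive_cases [consumes 1]:
  assumes "(i, j) \<in> positive"
    and "P 1 0" "P 0 1" "P 1 1" "P 2 1" "P 3 1" "P 3 2"
  shows "P i j"
  using assms unfolding positive_def by auto

lemma funpow_4: "(bracket y ^^ 4) v = bracket y (bracket y (bracket y (bracket y v)))"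
  by (simp add: numeral_eq_Suc)

text \<open>Each application moves one step along a \<rho>-string. The longest strings consist of
  four roots, and the one through 0 runs from -\<rho> to \<rho> in two steps, so that four steps
  leave every string.\<close>

lemma funpow_ad_4:
  assumes "(i, j) \<in> positive"
  shows "(bracket (e (rt i j)) ^^ 4) v = 0"
proof (induction v rule: linear_induct)
  case (basis v)
  show ?case
    by (rule base_basis_cases[OF basis]; rule positive_cases[OF assms];
      simp add: funpow_4 D_simps)
qed (simp_all add: funpow_bracket_add funpow_bracket_scale funpow_bracket_zero)

lemma funpow_ad_ge_4:
  assumes "(i, j) \<in> positive" and "k \<ge> 4"
  shows "(bracket (e (rt i j)) ^^ k) = (\<lambda>_. 0)"
proof
  fix v
  have "(bracket (e (rt i j)) ^^ k) v = (bracket (e (rt i j)) ^^ (k - 4)) ((bracket (e (rt i j))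
      ^^ 4) v)"
    using assms(2) by (metis funpow_add comp_apply le_add_diff_inverse2)
  then show "(bracket (e (rt i j)) ^^ k) v = 0"
    by (simp only: funpow_ad_4[OF assms(1)] funpow_bracket_zero)
qed

lemma D_lattice:
  assumes ij: "(i, j) \<in> positive" and "v \<in> lattice"
  shows "D i j k v \<in> lattice"
proof (cases "k < 4")
  case True
  then have k: "k = 0 \<or> k = 1 \<or> k = 2 \<or> k = 3" by auto
  show ?thesis
    using assms(2)
  proof (induction v rule: lattice_induct)
    case (basis v)
    show ?case
      using k by (elim disjE; simp only:) (rule base_basis_cases[OF basis]; rule positive_cases[OF
          ij];
        simp only: D_0 D_values lattice_zero lattice_add lattice_scale base_basis_lattice)+
  next
    case zero
    show ?case by (simp add: ad_divided_power_def funpow_bracket_zero lattice_zero)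
  qed (simp_all add: ad_divided_power_add ad_divided_power_scale lattice_add lattice_scale)
next
  case False
  then have "D i j k v = 0" using funpow_ad_ge_4[OF ij, of k] by (simp add: ad_divided_power_def)
  then show ?thesis by (simp add: lattice_zero)
qed

section \<open>The exponential on pure tensors\<close>

abbreviation degrees :: "int \<Rightarrow> int \<Rightarrow> nat set" where
  "degrees i j \<equiv> {k. bracket (e (rt i j)) ^^ k \<noteq> (\<lambda>_. 0)}"

lemma divided_power_family:
  "(i, j) \<in> positive \<Longrightarrow> divided_power_family lattice (D i j)"
  by standard (auto simp: D_lattice ad_divided_power_add)

abbreviation formal_root_exp :: "int \<Rightarrow> int \<Rightarrow> 'k::comm_ring_1 \<Rightarrow> ('k \<times> 'l \<Rightarrow>\<^sub>0 int) \<Rightarrow> ('k \<times> 'l \<Rightarrow>\<^sub>0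
    int)" where
  "formal_root_exp i j \<equiv> exp_ad_formal cscale bracket (e (rt i j))"

lemma formal_exp_eq:
  "(i, j) \<in> positive \<Longrightarrow> divided_power_family.formal_exp (D i j) (degrees i j) t = formal_root_exp i
      j t"
  by (simp add: divided_power_family.formal_exp_def[OF divided_power_family] exp_ad_formal_def)

abbreviation xr :: "int \<Rightarrow> int \<Rightarrow> 'k::comm_ring_1 \<Rightarrow> ('k, 'l) tensor \<Rightarrow> ('k, 'l) tensor" where
  "xr i j \<equiv> G2_root_element cscale bracket h e (rt i j)"

lemma exp_class_eq:
  "(i, j) \<in> positive \<Longrightarrow> divided_power_family.exp_class lattice (D i j) (degrees i j) t = xr i j t"
  by (simp add: divided_power_family.exp_class_def[OF divided_power_family] formal_exp_eq
      G2_root_element_def Let_def tensor_class_def)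

lemma root_element_class:
  assumes "(i, j) \<in> positive" "z \<in> carrier (formal_tensors lattice)"
  shows "xr i j t (tensor_class lattice z) = tensor_class lattice (formal_root_exp i j t z)"
  using divided_power_family.exp_class_tensor_class[OF divided_power_family[OF assms(1)] assms(2),
      where A = "degrees i j" and t = t]
  by (simp only: exp_class_eq[OF assms(1)] formal_exp_eq[OF assms(1)])

lemma formal_root_exp_add: "formal_root_exp i j t (z + w) = formal_root_exp i j t z +
    formal_root_exp i j t w"
  by (simp add: exp_ad_formal_def frag_extend_add)

lemma formal_root_exp_pure:
  fixes c :: "'k::comm_ring_1"
  assumes ij: "(i, j) \<in> positive"
  shows "tensor_class lattice (formal_root_exp i j t (frag_of (c, v))) =
    pure_tensor lattice c (D i j 0 v) + pure_tensor lattice (t * c) (D i j 1 v)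
      + pure_tensor lattice (t\<^sup>2 * c) (D i j 2 v) + pure_tensor lattice (t ^ 3 * c) (D i j 3 v)"
proof -
  define f where "f k = frag_of (t ^ k * c, D i j k v)" for k
  have sub: "degrees i j \<subseteq> {..<4}"
    using funpow_ad_ge_4[OF ij] by (auto simp: not_less[symmetric])
  \<comment> \<open>The range of orders depends on the root: for a long root the cube already
    vanishes. The surplus terms of the uniform range k < 4 are generators
    \<open>(t ^ k * c, 0)\<close>, which are nonzero in the free group but null in the tensor
    product.\<close>
  have "(\<Sum>k\<in>{..<4} - degrees i j. f k) \<in> tensor_null lattice"
  proof (rule null_sum)
    fix k assume "k \<in> {..<4} - degrees i j"
    then have "f k = frag_of (t ^ k * c, 0)" by (simp add: f_def ad_divided_power_def)
    then show "f k \<in> tensor_null lattice"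
      using pure_tensor_zero_right[of "t ^ k * c"] by (simp add: tensor_class_eq_iff)
  qed
  moreover have "(\<Sum>k<4. f k) = (\<Sum>k\<in>{..<4} - degrees i j. f k) + (\<Sum>k\<in>degrees i j. f k)"
    using sum.subset_diff[OF sub, of f] by simp
  ultimately have "tensor_class lattice (\<Sum>k\<in>degrees i j. f k) = tensor_class lattice (\<Sum>k<4. f k)"
    by (simp add: tensor_class_eq_iff) (use null_uminus in fastforce)
  also have "(\<Sum>k<4. f k) = f 0 + f 1 + f 2 + f 3"
    by (simp add: numeral_eq_Suc)
  finally show ?thesis
    by (simp add: exp_ad_formal_def f_def tensor_class_add)
qed

text \<open>The coordinates belong to \<open>h\<^sub>r\<close>, \<open>h\<^sub>s\<close>, the six positive roots and the six negative roots.\<close>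

primrec vec :: "'k coords \<Rightarrow> ('k::comm_ring_1 \<times> 'l \<Rightarrow>\<^sub>0 int)" where
  "vec (Coords c0 c1 c2 c3 c4 c5 c6 c7 c8 c9 c10 c11 c12 c13) =
    frag_of (c0, h (rt 1 0)) +
    frag_of (c1, h (rt 0 1)) +
    frag_of (c2, e (rt 1 0)) +
    frag_of (c3, e (rt 0 1)) +
    frag_of (c4, e (rt 1 1)) +
    frag_of (c5, e (rt 2 1)) +
    frag_of (c6, e (rt 3 1)) +
    frag_of (c7, e (rt 3 2)) +
    frag_of (c8, e (rt (- 1) 0)) +
    frag_of (c9, e (rt 0 (- 1))) +
    frag_of (c10, e (rt (- 1) (- 1))) +
    frag_of (c11, e (rt (- 2) (- 1))) +
    frag_of (c12, e (rt (- 3) (- 1))) +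
    frag_of (c13, e (rt (- 3) (- 2)))"

text \<open>This definition and the five after it are the matrices of the exponentials. A term
  \<open>of_int n * (t ^ k * c)\<close> in a slot says that the k-th divided power of the basis
  vector with coordinate \<open>c\<close> contains n times the basis vector of the slot. Even
  \<open>of_int 1\<close> is kept, since \<open>pure_tensor_scale\<close> produces exactly this
  form.\<close>

primrec X_1_0 :: "'k::comm_ring_1 \<Rightarrow> 'k coords \<Rightarrow> 'k coords" where
  "X_1_0 t (Coords c0 c1 c2 c3 c4 c5 c6 c7 c8 c9 c10 c11 c12 c13) = Coords
     (c0 + of_int 1 * (t * c8))
     c1
     (c2 + of_int (- 2) * (t * c0) + of_int 1 * (t * c1) + of_int (- 1) * (t\<^sup>2 * c8))
     c3
     (c4 + of_int \<epsilon>\<^sub>1 * (t * c3))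
     (c5 + of_int (\<epsilon>\<^sub>1 * \<epsilon>\<^sub>2) * (t\<^sup>2 * c3) + of_int (2 * \<epsilon>\<^sub>2) * (t * c4))
     (c6 + of_int (\<epsilon>\<^sub>1 * \<epsilon>\<^sub>2 * \<epsilon>\<^sub>3) * (t ^ 3 * c3) + of_int (3 * \<epsilon>\<^sub>2 * \<epsilon>\<^sub>3) * (t\<^sup>2 * c4) + of_int (3 *
         \<epsilon>\<^sub>3) * (t * c5))
     c7
     c8
     (c9 + of_int (- 3 * \<epsilon>\<^sub>1) * (t * c10) + of_int (3 * \<epsilon>\<^sub>1 * \<epsilon>\<^sub>2) * (t\<^sup>2 * c11) + of_int (- (\<epsilon>\<^sub>1 * \<epsilon>\<^sub>2
         * \<epsilon>\<^sub>3)) * (t ^ 3 * c12))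
     (c10 + of_int (- 2 * \<epsilon>\<^sub>2) * (t * c11) + of_int (\<epsilon>\<^sub>2 * \<epsilon>\<^sub>3) * (t\<^sup>2 * c12))
     (c11 + of_int (- \<epsilon>\<^sub>3) * (t * c12))
     c12
     c13"

primrec X_0_1 :: "'k::comm_ring_1 \<Rightarrow> 'k coords \<Rightarrow> 'k coords" where
  "X_0_1 t (Coords c0 c1 c2 c3 c4 c5 c6 c7 c8 c9 c10 c11 c12 c13) = Coords
     c0
     (c1 + of_int 1 * (t * c9))
     c2
     (c3 + of_int 3 * (t * c0) + of_int (- 2) * (t * c1) + of_int (- 1) * (t\<^sup>2 * c9))
     (c4 + of_int (- \<epsilon>\<^sub>1) * (t * c2))
     c5
     c6
     (c7 + of_int \<epsilon>\<^sub>4 * (t * c6))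
     (c8 + of_int \<epsilon>\<^sub>1 * (t * c10))
     c9
     c10
     c11
     (c12 + of_int (- \<epsilon>\<^sub>4) * (t * c13))
     c13"

primrec X_1_1 :: "'k::comm_ring_1 \<Rightarrow> 'k coords \<Rightarrow> 'k coords" where
  "X_1_1 t (Coords c0 c1 c2 c3 c4 c5 c6 c7 c8 c9 c10 c11 c12 c13) = Coords
     (c0 + of_int 1 * (t * c10))
     (c1 + of_int 3 * (t * c10))
     (c2 + of_int \<epsilon>\<^sub>1 * (t * c9))
     (c3 + of_int (- 3 * \<epsilon>\<^sub>1) * (t * c8) + of_int (- 3 * \<epsilon>\<^sub>1 * \<epsilon>\<^sub>2) * (t\<^sup>2 * c11) + of_int (- (\<epsilon>\<^sub>2 * \<epsilon>\<^sub>3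
         * \<epsilon>\<^sub>4)) * (t ^ 3 * c13))
     (c4 + of_int 1 * (t * c0) + of_int (- 1) * (t * c1) + of_int (- 1) * (t\<^sup>2 * c10))
     (c5 + of_int (- 2 * \<epsilon>\<^sub>2) * (t * c2) + of_int (- (\<epsilon>\<^sub>1 * \<epsilon>\<^sub>2)) * (t\<^sup>2 * c9))
     c6
     (c7 + of_int (3 * \<epsilon>\<^sub>1 * \<epsilon>\<^sub>2 * \<epsilon>\<^sub>3 * \<epsilon>\<^sub>4) * (t\<^sup>2 * c2) + of_int (- 3 * \<epsilon>\<^sub>1 * \<epsilon>\<^sub>3 * \<epsilon>\<^sub>4) * (t * c5) +
         of_int (\<epsilon>\<^sub>2 * \<epsilon>\<^sub>3 * \<epsilon>\<^sub>4) * (t ^ 3 * c9))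
     (c8 + of_int (2 * \<epsilon>\<^sub>2) * (t * c11) + of_int (\<epsilon>\<^sub>1 * \<epsilon>\<^sub>2 * \<epsilon>\<^sub>3 * \<epsilon>\<^sub>4) * (t\<^sup>2 * c13))
     c9
     c10
     (c11 + of_int (\<epsilon>\<^sub>1 * \<epsilon>\<^sub>3 * \<epsilon>\<^sub>4) * (t * c13))
     c12
     c13"

primrec X_2_1 :: "'k::comm_ring_1 \<Rightarrow> 'k coords \<Rightarrow> 'k coords" where
  "X_2_1 t (Coords c0 c1 c2 c3 c4 c5 c6 c7 c8 c9 c10 c11 c12 c13) = Coords
     (c0 + of_int 2 * (t * c11))
     (c1 + of_int 3 * (t * c11))
     (c2 + of_int (2 * \<epsilon>\<^sub>2) * (t * c10) + of_int (- (\<epsilon>\<^sub>1 * \<epsilon>\<^sub>2 * \<epsilon>\<^sub>3 * \<epsilon>\<^sub>4)) * (t\<^sup>2 * c13))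
     c3
     (c4 + of_int (- 2 * \<epsilon>\<^sub>2) * (t * c8) + of_int (- (\<epsilon>\<^sub>2 * \<epsilon>\<^sub>3)) * (t\<^sup>2 * c12))
     (c5 + of_int (- 1) * (t * c0) + of_int (- 1) * (t\<^sup>2 * c11))
     (c6 + of_int (- 3 * \<epsilon>\<^sub>3) * (t * c2) + of_int (- 3 * \<epsilon>\<^sub>2 * \<epsilon>\<^sub>3) * (t\<^sup>2 * c10) + of_int (\<epsilon>\<^sub>1 * \<epsilon>\<^sub>2 *
         \<epsilon>\<^sub>4) * (t ^ 3 * c13))
     (c7 + of_int (3 * \<epsilon>\<^sub>1 * \<epsilon>\<^sub>3 * \<epsilon>\<^sub>4) * (t * c4) + of_int (- 3 * \<epsilon>\<^sub>1 * \<epsilon>\<^sub>2 * \<epsilon>\<^sub>3 * \<epsilon>\<^sub>4) * (t\<^sup>2 * c8) +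
         of_int (- (\<epsilon>\<^sub>1 * \<epsilon>\<^sub>2 * \<epsilon>\<^sub>4)) * (t ^ 3 * c12))
     (c8 + of_int \<epsilon>\<^sub>3 * (t * c12))
     c9
     (c10 + of_int (- (\<epsilon>\<^sub>1 * \<epsilon>\<^sub>3 * \<epsilon>\<^sub>4)) * (t * c13))
     c11
     c12
     c13"

primrec X_3_1 :: "'k::comm_ring_1 \<Rightarrow> 'k coords \<Rightarrow> 'k coords" where
  "X_3_1 t (Coords c0 c1 c2 c3 c4 c5 c6 c7 c8 c9 c10 c11 c12 c13) = Coords
     (c0 + of_int 1 * (t * c12))
     (c1 + of_int 1 * (t * c12))
     (c2 + of_int \<epsilon>\<^sub>3 * (t * c11))
     c3
     c4
     (c5 + of_int (- \<epsilon>\<^sub>3) * (t * c8))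
     (c6 + of_int (- 3) * (t * c0) + of_int 1 * (t * c1) + of_int (- 1) * (t\<^sup>2 * c12))
     (c7 + of_int (- \<epsilon>\<^sub>4) * (t * c3))
     c8
     (c9 + of_int \<epsilon>\<^sub>4 * (t * c13))
     c10
     c11
     c12
     c13"

primrec X_3_2 :: "'k::comm_ring_1 \<Rightarrow> 'k coords \<Rightarrow> 'k coords" where
  "X_3_2 t (Coords c0 c1 c2 c3 c4 c5 c6 c7 c8 c9 c10 c11 c12 c13) = Coords
     (c0 + of_int 1 * (t * c13))
     (c1 + of_int 2 * (t * c13))
     c2
     (c3 + of_int \<epsilon>\<^sub>4 * (t * c12))
     (c4 + of_int (- (\<epsilon>\<^sub>1 * \<epsilon>\<^sub>3 * \<epsilon>\<^sub>4)) * (t * c11))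
     (c5 + of_int (\<epsilon>\<^sub>1 * \<epsilon>\<^sub>3 * \<epsilon>\<^sub>4) * (t * c10))
     (c6 + of_int (- \<epsilon>\<^sub>4) * (t * c9))
     (c7 + of_int (- 1) * (t * c1) + of_int (- 1) * (t\<^sup>2 * c13))
     c8
     c9
     c10
     c11
     c12
     c13"

lemma positive_simps: "(1, 0) \<in> positive" "(0, 1) \<in> positive" "(1, 1) \<in> positive"
  "(2, 1) \<in> positive" "(3, 1) \<in> positive" "(3, 2) \<in> positive"
  by (simp_all add: positive_def)

lemmas class_simps = vec.simps formal_root_exp_add tensor_class_add positive_simps[THEN
    formal_root_exp_pure]
  D_0 D_values pure_tensor_zero_right tensor_class_zero_add base_basis_lattice pure_tensor_scale
  pure_tensor_add_right pure_tensor_add_left lattice_scale add.assoc add.commute add.left_commute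

text \<open>Both sides are split completely into pure tensors of basis vectors, with all integers on
  the scalar side, and then agree up to the order of summands.\<close>

lemma class_X_1_0:
  "tensor_class lattice (formal_root_exp 1 0 t (vec c)) = tensor_class lattice (vec (X_1_0 t c))"
  by (cases c) (simp only: class_simps X_1_0.simps)

lemma class_X_0_1:
  "tensor_class lattice (formal_root_exp 0 1 t (vec c)) = tensor_class lattice (vec (X_0_1 t c))"
  by (cases c) (simp only: class_simps X_0_1.simps)

lemma class_X_1_1:
  "tensor_class lattice (formal_root_exp 1 1 t (vec c)) = tensor_class lattice (vec (X_1_1 t c))"
  by (cases c) (simp only: class_simps X_1_1.simps)

lemma class_X_2_1:
  "tensor_class lattice (formal_root_exp 2 1 t (vec c)) = tensor_class lattice (vec (X_2_1 t c))"
  by (cases c) (simp only: class_simps X_2_1.simps)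

lemma class_X_3_1:
  "tensor_class lattice (formal_root_exp 3 1 t (vec c)) = tensor_class lattice (vec (X_3_1 t c))"
  by (cases c) (simp only: class_simps X_3_1.simps)

lemma class_X_3_2:
  "tensor_class lattice (formal_root_exp 3 2 t (vec c)) = tensor_class lattice (vec (X_3_2 t c))"
  by (cases c) (simp only: class_simps X_3_2.simps)

section \<open>Polynomial identities between the coordinate maps\<close>

lemmas ring_simps = algebra_simps power2_eq_square power3_eq_cube signs

text \<open>The one-parameter law for t and -t; these six identities later provide the inverses of
  the root elements.\<close>

lemma X_1_0_uminus: "X_1_0 t (X_1_0 (- t) c) = c"
  by (cases c) (simp add: ring_simps)

lemma X_0_1_uminus: "X_0_1 t (X_0_1 (- t) c) = c"
  by (cases c) (simp add: ring_simps)

lemma X_1_1_uminus: "X_1_1 t (X_1_1 (- t) c) = c"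
  by (cases c) (simp add: ring_simps)

lemma X_2_1_uminus: "X_2_1 t (X_2_1 (- t) c) = c"
  by (cases c) (simp add: ring_simps)

lemma X_3_1_uminus: "X_3_1 t (X_3_1 (- t) c) = c"
  by (cases c) (simp add: ring_simps)

lemma X_3_2_uminus: "X_3_2 t (X_3_2 (- t) c) = c"
  by (cases c) (simp add: ring_simps)

text \<open>Two roots whose sum is a root form an angle of 150 degrees (long and short), 120 degrees
  (both short or both long) or 60 degrees (both short). The five identities treat one pair of each
  kind, at 150 degrees in both orders. A product of group elements appears as nested maps with its
  last factor innermost, and
  \<open>\<epsilon>\<^sub>1 * \<epsilon>\<^sub>3 * \<epsilon>\<^sub>4\<close> is the fifth
  sign.\<close>

lemma coords_commutator_long_short:
  "X_0_1 u (X_1_0 t c) = X_1_0 t (X_0_1 u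
     (X_1_1 (of_int (- \<epsilon>\<^sub>1) * (t * u)) (X_2_1 (of_int (\<epsilon>\<^sub>1 * \<epsilon>\<^sub>2) * (t^2 * u)) (X_3_1 (of_int (- \<epsilon>\<^sub>1 *
         \<epsilon>\<^sub>2 * \<epsilon>\<^sub>3) * (t^3 * u)) (X_3_2 (of_int (- \<epsilon>\<^sub>2 * \<epsilon>\<^sub>1 * \<epsilon>\<^sub>3 * \<epsilon>\<^sub>4) * (t^3 * u^2)) c)))))"
  by (cases c) (simp add: ring_simps)

lemma coords_commutator_short_long:
  "X_1_0 u (X_0_1 t c) = X_0_1 t (X_1_0 u
     (X_1_1 (of_int \<epsilon>\<^sub>1 * (t * u)) (X_2_1 (of_int (- \<epsilon>\<^sub>1 * \<epsilon>\<^sub>2) * (t * u^2)) (X_3_1 (of_int (\<epsilon>\<^sub>1 * \<epsilon>\<^sub>2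
         * \<epsilon>\<^sub>3) * (t * u^3)) (X_3_2 (of_int (- 2 * \<epsilon>\<^sub>2 * \<epsilon>\<^sub>1 * \<epsilon>\<^sub>3 * \<epsilon>\<^sub>4) * (t^2 * u^3)) c)))))"
  by (cases c) (simp add: ring_simps)

lemma coords_commutator_short_short_120:
  "X_1_1 u (X_1_0 t c) = X_1_0 t (X_1_1 u
     (X_2_1 (of_int (- 2 * \<epsilon>\<^sub>2) * (t * u)) (X_3_1 (of_int (3 * \<epsilon>\<^sub>2 * \<epsilon>\<^sub>3) * (t^2 * u)) (X_3_2 (of_int
         (- 3 * \<epsilon>\<^sub>2 * \<epsilon>\<^sub>1 * \<epsilon>\<^sub>3 * \<epsilon>\<^sub>4) * (t * u^2)) c))))"
  by (cases c) (simp add: ring_simps)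

lemma coords_commutator_long_long:
  "X_3_1 u (X_0_1 t c) = X_0_1 t (X_3_1 u
     (X_3_2 (of_int (- \<epsilon>\<^sub>4) * (t * u)) c))"
  by (cases c) (simp add: ring_simps)

lemma coords_commutator_short_short_60:
  "X_2_1 u (X_1_1 t c) = X_1_1 t (X_2_1 u
     (X_3_2 (of_int (3 * \<epsilon>\<^sub>1 * \<epsilon>\<^sub>3 * \<epsilon>\<^sub>4) * (t * u)) c))"
  by (cases c) (simp add: ring_simps)

end

section \<open>Commutator formulas for two positive roots\<close>

lemma (in group) commutator_eqI:
  assumes "x \<in> carrier G" "y \<in> carrier G" "z \<in> carrier G" "x \<otimes> y = y \<otimes> x \<otimes> z"
  shows "commutator G x y = z"
proof -
  define w where "w = y \<otimes> x"
  have w: "w \<in> carrier G" using assms(1,2) by (simp add: w_def)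
  have "inv x \<otimes> inv y \<otimes> x \<otimes> y = inv w \<otimes> (w \<otimes> z)"
    using assms by (simp add: w_def inv_mult_group m_assoc)
  also have "\<dots> = z"
    using w assms(3) by (simp flip: m_assoc)
  finally show ?thesis by (simp add: commutator_def)
qed

context G2_base
begin

section \<open>Every tensor has coordinates\<close>

primrec coords_add :: "'k::comm_ring_1 coords \<Rightarrow> 'k coords \<Rightarrow> 'k coords" where
  "coords_add (Coords a0 a1 a2 a3 a4 a5 a6 a7 a8 a9 a10 a11 a12 a13) d =
    (case d of Coords b0 b1 b2 b3 b4 b5 b6 b7 b8 b9 b10 b11 b12 b13 \<Rightarrow>
      Coords (a0 + b0) (a1 + b1) (a2 + b2) (a3 + b3) (a4 + b4) (a5 + b5) (a6 + b6) (a7 + b7)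
        (a8 + b8) (a9 + b9) (a10 + b10) (a11 + b11) (a12 + b12) (a13 + b13))"

text \<open>Subtraction in additive form: the elementwise operations on cosets provide sums, whereas
  \<open>carrier_induct\<close> produces differences.\<close>

lemma coords_add_surj:
  obtains c' where "c = coords_add c' d"
proof (cases c, cases d)
  fix a0 a1 a2 a3 a4 a5 a6 a7 a8 a9 a10 a11 a12 a13 b0 b1 b2 b3 b4 b5 b6 b7 b8 b9 b10 b11 b12 b13
  assume "c = Coords a0 a1 a2 a3 a4 a5 a6 a7 a8 a9 a10 a11 a12 a13"
    "d = Coords b0 b1 b2 b3 b4 b5 b6 b7 b8 b9 b10 b11 b12 b13"
  then show thesis
    by (intro that[of "Coords (a0 - b0) (a1 - b1) (a2 - b2) (a3 - b3) (a4 - b4) (a5 - b5) (a6 - b6)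
      (a7 - b7) (a8 - b8) (a9 - b9) (a10 - b10) (a11 - b11) (a12 - b12) (a13 - b13)"]) simp
qed

lemma class_vec_add:
  "tensor_class lattice (vec (coords_add c d)) =
    tensor_class lattice (vec c) + tensor_class lattice (vec d)"
  by (cases c, cases d) (simp only: coords_add.simps coords.case vec.simps tensor_class_add
      pure_tensor_add_left base_basis_lattice add.assoc add.commute add.left_commute)

lemma vec_carrier: "vec c \<in> carrier (formal_tensors lattice)"
  by (cases c) (simp only: vec.simps carrier_add frag_of_carrier base_basis_lattice)

lemma pure_tensor_basis:
  "pure_tensor lattice c (h (rt 1 0)) = tensor_class lattice (vec (Coords c 0 0 0 0 0 0 0 0 0 0 0
      0 0))"
  "pure_tensor lattice c (h (rt 0 1)) = tensor_class lattice (vec (Coords 0 c 0 0 0 0 0 0 0 0 0 0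
      0 0))"
  "pure_tensor lattice c (e (rt 1 0)) = tensor_class lattice (vec (Coords 0 0 c 0 0 0 0 0 0 0 0 0
      0 0))"
  "pure_tensor lattice c (e (rt 0 1)) = tensor_class lattice (vec (Coords 0 0 0 c 0 0 0 0 0 0 0 0
      0 0))"
  "pure_tensor lattice c (e (rt 1 1)) = tensor_class lattice (vec (Coords 0 0 0 0 c 0 0 0 0 0 0 0
      0 0))"
  "pure_tensor lattice c (e (rt 2 1)) = tensor_class lattice (vec (Coords 0 0 0 0 0 c 0 0 0 0 0 0
      0 0))"
  "pure_tensor lattice c (e (rt 3 1)) = tensor_class lattice (vec (Coords 0 0 0 0 0 0 c 0 0 0 0 0
      0 0))"
  "pure_tensor lattice c (e (rt 3 2)) = tensor_class lattice (vec (Coords 0 0 0 0 0 0 0 c 0 0 0 0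
      0 0))"
  "pure_tensor lattice c (e (rt (- 1) 0)) = tensor_class lattice (vec (Coords 0 0 0 0 0 0 0 0 c 0
      0 0 0 0))"
  "pure_tensor lattice c (e (rt 0 (- 1))) = tensor_class lattice (vec (Coords 0 0 0 0 0 0 0 0 0 c
      0 0 0 0))"
  "pure_tensor lattice c (e (rt (- 1) (- 1))) = tensor_class lattice (vec (Coords 0 0 0 0 0 0 0 0
      0 0 c 0 0 0))"
  "pure_tensor lattice c (e (rt (- 2) (- 1))) = tensor_class lattice (vec (Coords 0 0 0 0 0 0 0 0
      0 0 0 c 0 0))"
  "pure_tensor lattice c (e (rt (- 3) (- 1))) = tensor_class lattice (vec (Coords 0 0 0 0 0 0 0 0
      0 0 0 0 c 0))"
  "pure_tensor lattice c (e (rt (- 3) (- 2))) = tensor_class lattice (vec (Coords 0 0 0 0 0 0 0 0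
      0 0 0 0 0 c))"
  by (simp_all only: vec.simps tensor_class_add pure_tensor_zero_left base_basis_lattice
      tensor_class_zero_add)

lemma class_vec_pure:
  fixes c :: "'b::comm_ring_1"
  assumes "v \<in> lattice"
  shows "\<exists>d. pure_tensor lattice c v = tensor_class lattice (vec d)"
proof -
  \<comment> \<open>The scalar is quantified because scaling v by n replaces c by
    \<open>of_int n * c\<close>; membership of v is included because additivity of pure tensors
    requires it.\<close>
  have "v \<in> lattice \<and> (\<forall>c :: 'b. \<exists>d. pure_tensor lattice c v = tensor_class lattice (vec d))"
    using assms
  proof (induction v rule: lattice_induct)
    case zero
    have "pure_tensor lattice c 0 = tensor_class lattice (vec (Coords 0 0 0 0 0 0 0 0 0 0 0 0 0
        0))" for c :: 'b
      by (simp only: vec.simps tensor_class_add pure_tensor_zero_left pure_tensor_zero_right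
          base_basis_lattice tensor_class_zero_add)
    then show ?case using lattice_zero by blast
  next
    case (add v w)
    then show ?case
      by (metis lattice_add pure_tensor_add_right class_vec_add)
  next
    case (scale n v)
    then show ?case by (metis lattice_scale pure_tensor_scale)
  next
    case (basis v)
    show ?case
      by (rule base_basis_cases[OF basis]; intro conjI allI exI;
        rule base_basis_lattice pure_tensor_basis)
  qed
  then show ?thesis by blast
qed

text \<open>The fourteen generators of the lattice span the tensor product over the ring. This makes
  a map on tensors determined by its values on classes of coordinate vectors.\<close>

lemma class_vec_surj:
  assumes "z \<in> carrier (formal_tensors lattice)"
  obtains c where "tensor_class lattice z = tensor_class lattice (vec c)"
proof -
  have "\<exists>c. tensor_class lattice z = tensor_class lattice (vec c)"
    using assms
  proof (induction z rule: carrier_induct)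
    case zero
    show ?case using class_vec_pure[OF lattice_zero] by (metis pure_tensor_zero_right)
  next
    case (pure c v)
    then show ?case by (rule class_vec_pure)
  next
    case (diff z w)
    then obtain c d where c: "tensor_class lattice z = tensor_class lattice (vec c)"
      and d: "tensor_class lattice w = tensor_class lattice (vec d)" by blast
    obtain c' where "c = coords_add c' d" by (rule coords_add_surj)
    then have "tensor_class lattice z = tensor_class lattice (vec c' + w)"
      by (simp add: c class_vec_add tensor_class_add d)
    then have "tensor_class lattice (z - w) = tensor_class lattice (vec c')"
      by (simp add: tensor_class_eq_iff algebra_simps)
    then show ?case by blast
  qed
  then show ?thesis using that by blast
qed

lemma tensor_cases:
  assumes "T \<in> carrier (tensor_product lattice)"
  obtains c where "T = tensor_class lattice (vec c)"
  using assms class_vec_surj unfolding carrier_tensor_product by blast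

lemma class_vec_mem: "tensor_class lattice (vec c) \<in> carrier (tensor_product lattice)"
  unfolding carrier_tensor_product using vec_carrier by blast

section \<open>Group elements acting through coordinate maps\<close>

abbreviation chevalley_group :: "(('k::comm_ring_1, 'l) tensor \<Rightarrow> ('k, 'l) tensor) monoid" where
  "chevalley_group \<equiv> G2_chevalley_group cscale bracket h e"

text \<open>The link between the group and the coordinates: it is stable under products
  (\<open>acts_as_mult\<close>), and a coordinate map determines the group element
  (\<open>acts_as_unique\<close>). Thus equations between coordinate maps become equations in the
  group.\<close>

definition acts_as ::
    "(('k::comm_ring_1, 'l) tensor \<Rightarrow> ('k, 'l) tensor) \<Rightarrow> ('k coords \<Rightarrow> 'k coords) \<Rightarrow> bool" where
  "acts_as f F \<longleftrightarrow> f \<in> carrier chevalley_group \<and>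
     (\<forall>c. f (tensor_class lattice (vec c)) = tensor_class lattice (vec (F c)))"

lemma group_chevalley_group: "group (chevalley_group :: (('k::comm_ring_1, 'l) tensor \<Rightarrow> ('k, 'l)
    tensor) monoid)"
  unfolding G2_chevalley_group_def by (rule group.group_subgroup_generated[OF group_BijGroup])

lemma carrier_chevalley_group_Bij:
  "f \<in> carrier (chevalley_group :: (('k::comm_ring_1, 'l) tensor \<Rightarrow> ('k, 'l) tensor) monoid)
    \<Longrightarrow> f \<in> Bij (carrier (tensor_product lattice))"
  using group.carrier_subgroup_generated_subset[OF group_BijGroup]
  unfolding G2_chevalley_group_def by (fastforce simp: BijGroup_def)

lemma acts_as_mult:
  assumes "acts_as f F" "acts_as g H"
  shows "acts_as (f \<otimes>\<^bsub>chevalley_group\<^esub> g) (F \<circ> H)"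
  unfolding acts_as_def
proof (intro conjI allI)
  have fg: "f \<in> carrier chevalley_group" "g \<in> carrier chevalley_group"
    using assms unfolding acts_as_def by blast+
  then show "f \<otimes>\<^bsub>chevalley_group\<^esub> g \<in> carrier chevalley_group"
    by (rule monoid.m_closed[OF group.is_monoid[OF group_chevalley_group]])
  have "f \<otimes>\<^bsub>chevalley_group\<^esub> g = compose (carrier (tensor_product lattice)) f g"
    unfolding G2_chevalley_group_def mult_subgroup_generated
    using fg[THEN carrier_chevalley_group_Bij] by (simp add: BijGroup_def)
  then show "(f \<otimes>\<^bsub>chevalley_group\<^esub> g) (tensor_class lattice (vec c)) = tensor_class lattice (vec ((F
      \<circ> H) c))" for c
    using assms by (simp only: compose_eq class_vec_mem acts_as_def comp_apply)
qed

text \<open>Elements of \<open>BijGroup\<close> are extensional, hence determined by their values on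
  tensors, and each tensor is the class of a coordinate vector.\<close>

lemma acts_as_unique:
  assumes "acts_as f F" "acts_as g F"
  shows "f = g"
proof (rule extensionalityI)
  show "f \<in> extensional (carrier (tensor_product lattice))"
    "g \<in> extensional (carrier (tensor_product lattice))"
    using assms by (simp_all add: acts_as_def carrier_chevalley_group_Bij Bij_imp_extensional)
  show "f T = g T" if "T \<in> carrier (tensor_product lattice)" for T
    using that assms by (auto elim!: tensor_cases simp: acts_as_def)
qed

lemma acts_as_commutator:
  assumes "acts_as f F" "acts_as g H" "acts_as k L" and "\<And>c. F (H c) = H (F (L c))"
  shows "commutator chevalley_group f g = k"
proof (rule group.commutator_eqI[OF group_chevalley_group])
  show "f \<otimes>\<^bsub>chevalley_group\<^esub> g = g \<otimes>\<^bsub>chevalley_group\<^esub> f \<otimes>\<^bsub>chevalley_group\<^esub> k"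
    using acts_as_mult[OF assms(1,2)] acts_as_mult[OF acts_as_mult[OF assms(2,1)] assms(3)] assms(4)
    by (intro acts_as_unique[where F = "F \<circ> H"]) (simp_all add: comp_def)
qed (use assms in \<open>simp_all add: acts_as_def\<close>)

text \<open>\<open>subgroup_generated\<close> keeps only those generators that lie in the ambient
  group. A root element must therefore first be shown to be a bijection, with inverse
  \<open>xr i j (- t)\<close>.\<close>

lemma acts_as_root_element:
  fixes F :: "'b::comm_ring_1 \<Rightarrow> 'b coords \<Rightarrow> 'b coords"
  assumes ij: "(i, j) \<in> positive"
    and F: "\<And>t c. tensor_class lattice (formal_root_exp i j t (vec c)) = tensor_class lattice (vec
        (F t c))"
    and F_uminus: "\<And>t c. F t (F (- t) c) = c"
  shows "acts_as (xr i j t) (F t)"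
proof -
  have act: "xr i j t (tensor_class lattice (vec c)) = tensor_class lattice (vec (F t c))" for t c
    using root_element_class[OF ij vec_carrier] F by (rule trans)
  have F_uminus': "F (- t) (F t c) = c" for t c
    using F_uminus[of "- t" c] by simp
  have "bij_betw (xr i j t) (carrier (tensor_product lattice)) (carrier (tensor_product lattice))"
    by (rule bij_betw_byWitness[where f' = "xr i j (- t)"])
      (auto elim!: tensor_cases simp: act F_uminus F_uminus' class_vec_mem)
  moreover have "xr i j t \<in> extensional (carrier (tensor_product lattice))"
    by (simp add: G2_root_element_def Let_def)
  ultimately have "xr i j t \<in> carrier (BijGroup (carrier (tensor_product lattice)))"
    by (simp add: BijGroup_def Bij_def)
  moreover have "rt i j \<in> G2_roots"
    using ij by (auto simp: positive_def rt_mem_iff G2_coeffs_def)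
  ultimately have "xr i j t \<in> carrier chevalley_group"
    unfolding G2_chevalley_group_def carrier_subgroup_generated by (auto intro!: generate.incl)
  with act show ?thesis by (simp add: acts_as_def)
qed

lemma acts_as_X:
  "acts_as (xr 1 0 t) (X_1_0 t)"
  "acts_as (xr 0 1 t) (X_0_1 t)"
  "acts_as (xr 1 1 t) (X_1_1 t)"
  "acts_as (xr 2 1 t) (X_2_1 t)"
  "acts_as (xr 3 1 t) (X_3_1 t)"
  "acts_as (xr 3 2 t) (X_3_2 t)"
  by (rule acts_as_root_element; simp add: positive_simps class_X_1_0 class_X_0_1 class_X_1_1
      class_X_2_1
      class_X_3_1 class_X_3_2 X_1_0_uminus X_0_1_uminus X_1_1_uminus X_2_1_uminus X_3_1_uminus
          X_3_2_uminus)+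

text \<open>Roots and ring arguments enter through equations, so that the rule applies however they
  are written; the equations remain as separate goals about vectors and ring elements. The four
  rules after it have the same form.\<close>

lemma commutator_long_short:
  fixes t u :: "'k::comm_ring_1"
  defines "x \<equiv> G2_root_element cscale bracket h e"
  assumes "\<alpha> = rt 0 1" "\<beta> = rt 1 0"
    "\<gamma>\<^sub>1 = rt 1 1" "v\<^sub>1 = of_int (- \<epsilon>\<^sub>1) * (t * u)"
    "\<gamma>\<^sub>2 = rt 2 1" "v\<^sub>2 = of_int (\<epsilon>\<^sub>1 * \<epsilon>\<^sub>2) * (t^2 * u)"
    "\<gamma>\<^sub>3 = rt 3 1" "v\<^sub>3 = of_int (- \<epsilon>\<^sub>1 * \<epsilon>\<^sub>2 * \<epsilon>\<^sub>3) * (t^3 * u)"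
    "\<gamma>\<^sub>4 = rt 3 2" "v\<^sub>4 = of_int (- \<epsilon>\<^sub>2 * \<epsilon>\<^sub>1 * \<epsilon>\<^sub>3 * \<epsilon>\<^sub>4) * (t^3 * u^2)"
  shows "commutator chevalley_group (x \<alpha> u) (x \<beta> t) = x \<gamma>\<^sub>1 v\<^sub>1
      \<otimes>\<^bsub>chevalley_group\<^esub> x \<gamma>\<^sub>2 v\<^sub>2
      \<otimes>\<^bsub>chevalley_group\<^esub> x \<gamma>\<^sub>3 v\<^sub>3
      \<otimes>\<^bsub>chevalley_group\<^esub> x \<gamma>\<^sub>4 v\<^sub>4"
  unfolding assms
  by (rule acts_as_commutator[OF acts_as_X(2) acts_as_X(1) acts_as_mult[OF acts_as_mult[OF
      acts_as_mult[OF acts_as_X(3) acts_as_X(4)] acts_as_X(5)] acts_as_X(6)]])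
    (simp only: comp_apply coords_commutator_long_short)

lemma commutator_short_long:
  fixes t u :: "'k::comm_ring_1"
  defines "x \<equiv> G2_root_element cscale bracket h e"
  assumes "\<alpha> = rt 1 0" "\<beta> = rt 0 1"
    "\<gamma>\<^sub>1 = rt 1 1" "v\<^sub>1 = of_int \<epsilon>\<^sub>1 * (t * u)"
    "\<gamma>\<^sub>2 = rt 2 1" "v\<^sub>2 = of_int (- \<epsilon>\<^sub>1 * \<epsilon>\<^sub>2) * (t * u^2)"
    "\<gamma>\<^sub>3 = rt 3 1" "v\<^sub>3 = of_int (\<epsilon>\<^sub>1 * \<epsilon>\<^sub>2 * \<epsilon>\<^sub>3) * (t * u^3)"
    "\<gamma>\<^sub>4 = rt 3 2" "v\<^sub>4 = of_int (- 2 * \<epsilon>\<^sub>2 * \<epsilon>\<^sub>1 * \<epsilon>\<^sub>3 * \<epsilon>\<^sub>4) * (t^2 * u^3)"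
  shows "commutator chevalley_group (x \<alpha> u) (x \<beta> t) = x \<gamma>\<^sub>1 v\<^sub>1
      \<otimes>\<^bsub>chevalley_group\<^esub> x \<gamma>\<^sub>2 v\<^sub>2
      \<otimes>\<^bsub>chevalley_group\<^esub> x \<gamma>\<^sub>3 v\<^sub>3
      \<otimes>\<^bsub>chevalley_group\<^esub> x \<gamma>\<^sub>4 v\<^sub>4"
  unfolding assms
  by (rule acts_as_commutator[OF acts_as_X(1) acts_as_X(2) acts_as_mult[OF acts_as_mult[OF
      acts_as_mult[OF acts_as_X(3) acts_as_X(4)] acts_as_X(5)] acts_as_X(6)]])
    (simp only: comp_apply coords_commutator_short_long)

lemma commutator_short_short_120:
  fixes t u :: "'k::comm_ring_1"
  defines "x \<equiv> G2_root_element cscale bracket h e"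
  assumes "\<alpha> = rt 1 1" "\<beta> = rt 1 0"
    "\<gamma>\<^sub>1 = rt 2 1" "v\<^sub>1 = of_int (- 2 * \<epsilon>\<^sub>2) * (t * u)"
    "\<gamma>\<^sub>2 = rt 3 1" "v\<^sub>2 = of_int (3 * \<epsilon>\<^sub>2 * \<epsilon>\<^sub>3) * (t^2 * u)"
    "\<gamma>\<^sub>3 = rt 3 2" "v\<^sub>3 = of_int (- 3 * \<epsilon>\<^sub>2 * \<epsilon>\<^sub>1 * \<epsilon>\<^sub>3 * \<epsilon>\<^sub>4) * (t * u^2)"
  shows "commutator chevalley_group (x \<alpha> u) (x \<beta> t) = x \<gamma>\<^sub>1 v\<^sub>1
      \<otimes>\<^bsub>chevalley_group\<^esub> x \<gamma>\<^sub>2 v\<^sub>2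
      \<otimes>\<^bsub>chevalley_group\<^esub> x \<gamma>\<^sub>3 v\<^sub>3"
  unfolding assms
  by (rule acts_as_commutator[OF acts_as_X(3) acts_as_X(1) acts_as_mult[OF acts_as_mult[OF
      acts_as_X(4) acts_as_X(5)] acts_as_X(6)]])
    (simp only: comp_apply coords_commutator_short_short_120)

lemma commutator_long_long:
  fixes t u :: "'k::comm_ring_1"
  defines "x \<equiv> G2_root_element cscale bracket h e"
  assumes "\<alpha> = rt 3 1" "\<beta> = rt 0 1"
    "\<gamma>\<^sub>1 = rt 3 2" "v\<^sub>1 = of_int (- \<epsilon>\<^sub>4) * (t * u)"
  shows "commutator chevalley_group (x \<alpha> u) (x \<beta> t) = x \<gamma>\<^sub>1 v\<^sub>1"
  unfolding assms
  by (rule acts_as_commutator[OF acts_as_X(5) acts_as_X(2) acts_as_X(6)])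
    (simp only: comp_apply coords_commutator_long_long)

lemma commutator_short_short_60:
  fixes t u :: "'k::comm_ring_1"
  defines "x \<equiv> G2_root_element cscale bracket h e"
  assumes "\<alpha> = rt 2 1" "\<beta> = rt 1 1"
    "\<gamma>\<^sub>1 = rt 3 2" "v\<^sub>1 = of_int (3 * \<epsilon>\<^sub>1 * \<epsilon>\<^sub>3 * \<epsilon>\<^sub>4) * (t * u)"
  shows "commutator chevalley_group (x \<alpha> u) (x \<beta> t) = x \<gamma>\<^sub>1 v\<^sub>1"
  unfolding assms
  by (rule acts_as_commutator[OF acts_as_X(4) acts_as_X(3) acts_as_X(6)])
    (simp only: comp_apply coords_commutator_short_short_60)

section \<open>Transfer to arbitrary pairs of roots\<close>

text \<open>In coefficients, a Weyl group element is an integer matrix with rows (i, j) and (k, l)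
  that permutes \<open>G2_coeffs\<close>. The first two Gram conditions are halves of the norms 2
  and 6. All premises on the new pair are finite computations with integers and
  \<open>N_table\<close>.\<close>

lemma base_change:
  assumes ij: "(i, j) \<in> G2_coeffs" and kl: "(k, l) \<in> G2_coeffs"
    and gram: "i * i + 3 * j * j - 3 * i * j = 1" "k * k + 3 * l * l - 3 * k * l = 3"
      "2 * i * k + 6 * j * l - 3 * (i * l + j * k) = - 3"
    and roots: "(\<lambda>(m, n). (m * i + n * k, m * j + n * l)) ` G2_coeffs = G2_coeffs"
    and N: "N (rt i j) (rt k l) = \<delta>\<^sub>1" "N (rt i j) (rt (i + k) (j + l)) = 2 * \<delta>\<^sub>2"
      "N (rt i j) (rt (2 * i + k) (2 * j + l)) = 3 * \<delta>\<^sub>3"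
      "N (rt k l) (rt (3 * i + k) (3 * j + l)) = \<delta>\<^sub>4"
    and sign': "\<delta>\<^sub>1 * \<delta>\<^sub>1 = 1" "\<delta>\<^sub>2 * \<delta>\<^sub>2 = 1" "\<delta>\<^sub>3 * \<delta>\<^sub>3 = 1" "\<delta>\<^sub>4 * \<delta>\<^sub>4 = 1"
  shows "G2_base cscale bracket h e N (rt i j) (rt k l) \<delta>\<^sub>1 \<delta>\<^sub>2 \<delta>\<^sub>3 \<delta>\<^sub>4"
proof
  have "2 * i * i + 6 * j * j - 3 * (i * j + j * i) = 2" "2 * k * k + 6 * l * l - 3 * (k * l + l *
      k) = 6"
    using gram by (simp_all add: algebra_simps)
  then show "rt i j \<bullet> rt i j = 2" "rt k l \<bullet> rt k l = 6" "rt i j \<bullet> rt k l = - 3"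
    unfolding inner_rt gram(3) by (simp_all only: of_int_numeral of_int_minus)
  have "G2_roots = (\<lambda>(m, n). rt m n) ` (\<lambda>(m, n). (m * i + n * k, m * j + n * l)) ` G2_coeffs"
    by (simp only: roots roots_eq)
  then show "G2_roots = (\<lambda>(m, n). root_comb (rt i j) (rt k l) m n) ` G2_coeffs"
    by (simp add: image_image root_comb_comb case_prod_beta)
qed (use N sign' in \<open>simp_all add: root_comb_comb\<close>)

lemma sign_cancel:
  "\<epsilon>\<^sub>1 * (\<epsilon>\<^sub>1 * n) = n" "\<epsilon>\<^sub>2 * (\<epsilon>\<^sub>2 * n) = n" "\<epsilon>\<^sub>3 * (\<epsilon>\<^sub>3 * n) = n" "\<epsilon>\<^sub>4 * (\<epsilon>\<^sub>4 * n) = n"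
  by (simp_all add: sign flip: mult.assoc)

text \<open>Each of the six short roots has inner product -3 with exactly two long roots, hence the
  rows come in pairs. The signs are the entries of \<open>N_table\<close> for the new pair, divided
  by 1, 2, 3 and 1.\<close>

lemma bases:
  "G2_base cscale bracket h e N (rt 1 0) (rt 0 1) \<epsilon>\<^sub>1 \<epsilon>\<^sub>2 \<epsilon>\<^sub>3 \<epsilon>\<^sub>4"
  "G2_base cscale bracket h e N (rt 1 0) (rt (- 3) (- 1)) (- \<epsilon>\<^sub>3) (- \<epsilon>\<^sub>2) (- \<epsilon>\<^sub>1) \<epsilon>\<^sub>4"
  "G2_base cscale bracket h e N (rt 1 1) (rt 0 (- 1)) \<epsilon>\<^sub>1 (- \<epsilon>\<^sub>2) (- (\<epsilon>\<^sub>1 * \<epsilon>\<^sub>3 * \<epsilon>\<^sub>4)) \<epsilon>\<^sub>4"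
  "G2_base cscale bracket h e N (rt 1 1) (rt (- 3) (- 2)) (\<epsilon>\<^sub>1 * \<epsilon>\<^sub>3 * \<epsilon>\<^sub>4) \<epsilon>\<^sub>2 (- \<epsilon>\<^sub>1) \<epsilon>\<^sub>4"
  "G2_base cscale bracket h e N (rt 2 1) (rt (- 3) (- 1)) \<epsilon>\<^sub>3 (- \<epsilon>\<^sub>2) (\<epsilon>\<^sub>1 * \<epsilon>\<^sub>3 * \<epsilon>\<^sub>4) (- \<epsilon>\<^sub>4)"
  "G2_base cscale bracket h e N (rt 2 1) (rt (- 3) (- 2)) (- (\<epsilon>\<^sub>1 * \<epsilon>\<^sub>3 * \<epsilon>\<^sub>4)) \<epsilon>\<^sub>2 (- \<epsilon>\<^sub>3) (- \<epsilon>\<^sub>4)"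
  "G2_base cscale bracket h e N (rt (- 1) 0) (rt 3 1) \<epsilon>\<^sub>3 \<epsilon>\<^sub>2 \<epsilon>\<^sub>1 (- \<epsilon>\<^sub>4)"
  "G2_base cscale bracket h e N (rt (- 1) 0) (rt 0 (- 1)) (- \<epsilon>\<^sub>1) (- \<epsilon>\<^sub>2) (- \<epsilon>\<^sub>3) (- \<epsilon>\<^sub>4)"
  "G2_base cscale bracket h e N (rt (- 1) (- 1)) (rt 0 1) (- \<epsilon>\<^sub>1) \<epsilon>\<^sub>2 (\<epsilon>\<^sub>1 * \<epsilon>\<^sub>3 * \<epsilon>\<^sub>4) (- \<epsilon>\<^sub>4)"
  "G2_base cscale bracket h e N (rt (- 1) (- 1)) (rt 3 2) (- (\<epsilon>\<^sub>1 * \<epsilon>\<^sub>3 * \<epsilon>\<^sub>4)) (- \<epsilon>\<^sub>2) \<epsilon>\<^sub>1 (- \<epsilon>\<^sub>4)"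
  "G2_base cscale bracket h e N (rt (- 2) (- 1)) (rt 3 1) (- \<epsilon>\<^sub>3) \<epsilon>\<^sub>2 (- (\<epsilon>\<^sub>1 * \<epsilon>\<^sub>3 * \<epsilon>\<^sub>4)) \<epsilon>\<^sub>4"
  "G2_base cscale bracket h e N (rt (- 2) (- 1)) (rt 3 2) (\<epsilon>\<^sub>1 * \<epsilon>\<^sub>3 * \<epsilon>\<^sub>4) (- \<epsilon>\<^sub>2) \<epsilon>\<^sub>3 \<epsilon>\<^sub>4"
  by (rule base_change;
    auto simp: G2_coeffs_def N_table sign sign_cancel mult.assoc mult.commute mult.left_commute)+

end

section \<open>Root strings and the signs of the pair (a, b)\<close>

lemma string_down_eqI:
  assumes "r \<in> G2_roots" "s - of_int m *\<^sub>R r \<in> G2_roots"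
    and large: "\<And>p :: int. p > m \<Longrightarrow> s \<bullet> s - 2 * of_int p * (r \<bullet> s) + (of_int p)\<^sup>2 * (r \<bullet> r) > 6"
  shows "string_down r s = m"
  unfolding string_down_def
proof (rule Max_eqI)
  have "inj (\<lambda>p :: int. s - of_int p *\<^sub>R r)"
    using G2_root_nonzero[OF assms(1)] by (auto simp: inj_def)
  moreover have "finite G2_roots" by (simp add: G2_roots_def Let_def)
  ultimately show "finite {p :: int. s - of_int p *\<^sub>R r \<in> G2_roots}"
    using finite_vimageI[of G2_roots "\<lambda>p :: int. s - of_int p *\<^sub>R r"] by (simp add: vimage_def)
  \<comment> \<open>Beyond m the vector s - p r has norm above 6, the largest norm of a
    root.\<close>
  show "p \<le> m" if "p \<in> {p. s - of_int p *\<^sub>R r \<in> G2_roots}" for p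
  proof (rule ccontr)
    assume "\<not> p \<le> m"
    then have "s \<bullet> s - 2 * of_int p * (r \<bullet> s) + (of_int p)\<^sup>2 * (r \<bullet> r) > 6"
      using large by simp
    also have "s \<bullet> s - 2 * of_int p * (r \<bullet> s) + (of_int p)\<^sup>2 * (r \<bullet> r)
        = (s - of_int p *\<^sub>R r) \<bullet> (s - of_int p *\<^sub>R r)"
      by (simp add: inner_diff_left inner_diff_right inner_commute power2_eq_square algebra_simps)
    finally show False using G2_root_norm[of "s - of_int p *\<^sub>R r"] that by auto
  qed
qed (use assms in simp)

lemma string_down_values:
  "string_down G2_a G2_b = 0"
  "string_down G2_a (G2_a + G2_b) = 1"
  "string_down G2_a (2 *\<^sub>R G2_a + G2_b) = 2"
  "string_down G2_b (3 *\<^sub>R G2_a + G2_b) = 0"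
proof -
  have ab: "G2_a \<in> G2_roots" "G2_b \<in> G2_roots" "3 *\<^sub>R G2_a + G2_b \<in> G2_roots"
    by (simp_all add: G2_roots_def Let_def)
  note inner = G2_inner inner_add_left inner_add_right power2_eq_square
  have square: "real_of_int p * of_int p > 0" if "p > 0" for p
    using that by simp
  \<comment> \<open>The inner products of a with a + b and 2a + b are -1 and 1, so the norms along
    these strings are 2p(p + 1) + 2 and 2p(p - 1) + 2. They exceed 6 for p > 1 and p > 2
    respectively.\<close>
  have "p * (p + 1) \<ge> 2 * 3" if "p > 1" for p :: int
    using that by (intro mult_mono) auto
  then have large: "real_of_int p * of_int p + of_int p \<ge> 6" if "p > 1" for p
    using that by (simp add: algebra_simps flip: of_int_mult of_int_add)
  have "p * (p - 1) \<ge> 3 * 2" if "p > 2" for p :: int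
    using that by (intro mult_mono) auto
  then have large': "real_of_int p * of_int p - of_int p \<ge> 6" if "p > 2" for p
    using that by (simp add: algebra_simps flip: of_int_mult of_int_diff)
  show "string_down G2_a G2_b = 0"
    using ab square by (intro string_down_eqI) (auto simp: inner add_pos_pos)
  show "string_down G2_b (3 *\<^sub>R G2_a + G2_b) = 0"
    using ab square by (intro string_down_eqI) (auto simp: inner add_pos_pos)
  show "string_down G2_a (G2_a + G2_b) = 1"
    using ab by (intro string_down_eqI) (auto simp: inner dest: large)
  show "string_down G2_a (2 *\<^sub>R G2_a + G2_b) = 2"
    using ab by (intro string_down_eqI) (auto simp: inner dest: large')
qed

text \<open>The strings descend by 0, 1, 2 and 0 steps, so \<open>N_abs\<close> gives the absolute
  values 1, 2, 3 and 1; dividing by them leaves signs.\<close>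

lemma (in G2_chevalley_basis) G2_base_a_b:
  assumes N: "N G2_a G2_b = \<epsilon>\<^sub>1" "N G2_a (G2_a + G2_b) = 2 * \<epsilon>\<^sub>2"
      "N G2_a (2 *\<^sub>R G2_a + G2_b) = 3 * \<epsilon>\<^sub>3" "N G2_b (3 *\<^sub>R G2_a + G2_b) = \<epsilon>\<^sub>4"
  shows "G2_base cscale bracket h e N G2_a G2_b \<epsilon>\<^sub>1 \<epsilon>\<^sub>2 \<epsilon>\<^sub>3 \<epsilon>\<^sub>4"
proof
  have sums: "G2_a + (G2_a + G2_b) = 2 *\<^sub>R G2_a + G2_b"
    "G2_a + (2 *\<^sub>R G2_a + G2_b) = 3 *\<^sub>R G2_a + G2_b"
    "G2_b + (3 *\<^sub>R G2_a + G2_b) = 3 *\<^sub>R G2_a + 2 *\<^sub>R G2_b"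
    by (simp_all add: vec_eq_iff)
  have rts: "G2_a \<in> G2_roots" "G2_b \<in> G2_roots" "G2_a + G2_b \<in> G2_roots"
    "2 *\<^sub>R G2_a + G2_b \<in> G2_roots" "3 *\<^sub>R G2_a + G2_b \<in> G2_roots"
    "G2_a + (G2_a + G2_b) \<in> G2_roots" "G2_a + (2 *\<^sub>R G2_a + G2_b) \<in> G2_roots"
    "G2_b + (3 *\<^sub>R G2_a + G2_b) \<in> G2_roots"
    by (simp_all add: G2_roots_def Let_def sums)
  show "\<epsilon>\<^sub>1 * \<epsilon>\<^sub>1 = 1" "\<epsilon>\<^sub>2 * \<epsilon>\<^sub>2 = 1" "\<epsilon>\<^sub>3 * \<epsilon>\<^sub>3 = 1" "\<epsilon>\<^sub>4 * \<epsilon>\<^sub>4 = 1"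
    using N_abs[OF rts(1,2,3)] N_abs[OF rts(1,3,6)] N_abs[OF rts(1,4,7)] N_abs[OF rts(2,5,8)]
    unfolding N string_down_values by auto
qed (simp_all add: G2_inner G2_roots_coeffs N root_comb_def flip: N)

theorem mainTheorem3:
  fixes cscale :: "complex \<Rightarrow> 'l::ab_group_add \<Rightarrow> 'l"
    and bracket :: "'l \<Rightarrow> 'l \<Rightarrow> 'l"
    and h e :: "real^3 \<Rightarrow> 'l"
    and N :: "real^3 \<Rightarrow> real^3 \<Rightarrow> int"
    and a b :: "real^3"
    and \<epsilon>\<^sub>1 \<epsilon>\<^sub>2 \<epsilon>\<^sub>3 \<epsilon>\<^sub>4 \<epsilon>\<^sub>5 :: int
    and t u :: "'k::comm_ring_1"
    and x :: "real^3 \<Rightarrow> 'k \<Rightarrow> ('k, 'l) tensor \<Rightarrow> ('k, 'l) tensor"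
    and G :: "(('k, 'l) tensor \<Rightarrow> ('k, 'l) tensor) monoid" (structure)
  defines "a \<equiv> G2_a" and "b \<equiv> G2_b"
    and "x \<equiv> G2_root_element cscale bracket h e"
    and "G \<equiv> G2_chevalley_group cscale bracket h e"
  assumes "G2_chevalley_basis cscale bracket h e N"
    and "N a b = \<epsilon>\<^sub>1"
    and "N a (a + b) = 2 * \<epsilon>\<^sub>2"
    and "N a (2 *\<^sub>R a + b) = 3 * \<epsilon>\<^sub>3"
    and "N b (3 *\<^sub>R a + b) = \<epsilon>\<^sub>4"
    and "real_of_int \<epsilon>\<^sub>5 = real_of_int (\<epsilon>\<^sub>1 * \<epsilon>\<^sub>3) / real_of_int \<epsilon>\<^sub>4"
  shows "commutator G (x b u) (x a t)
      = x (a + b) (of_int (- \<epsilon>\<^sub>1) * t * u) \<otimes> x (2 *\<^sub>R a + b) (of_int (\<epsilon>\<^sub>1 * \<epsilon>\<^sub>2) * t^2 * u)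
          \<otimes> x (3 *\<^sub>R a + b) (of_int (- \<epsilon>\<^sub>1 * \<epsilon>\<^sub>2 * \<epsilon>\<^sub>3) * t^3 * u) \<otimes> x (3 *\<^sub>R a + 2 *\<^sub>R b) (of_int (- \<epsilon>\<^sub>2 * \<epsilon>\<^sub>5) * t^3 * u^2)
    \<and> commutator G (x a u) (x b t)
      = x (a + b) (of_int \<epsilon>\<^sub>1 * t * u) \<otimes> x (2 *\<^sub>R a + b) (of_int (- \<epsilon>\<^sub>1 * \<epsilon>\<^sub>2) * t * u^2)
          \<otimes> x (3 *\<^sub>R a + b) (of_int (\<epsilon>\<^sub>1 * \<epsilon>\<^sub>2 * \<epsilon>\<^sub>3) * t * u^3) \<otimes> x (3 *\<^sub>R a + 2 *\<^sub>R b) (of_int (- 2 * \<epsilon>\<^sub>2 * \<epsilon>\<^sub>5) * t^2 * u^3)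
    \<and> commutator G (x (a + b) u) (x a t)
      = x (2 *\<^sub>R a + b) (of_int (- 2 * \<epsilon>\<^sub>2) * t * u) \<otimes> x (3 *\<^sub>R a + b) (of_int (3 * \<epsilon>\<^sub>2 * \<epsilon>\<^sub>3) * t^2 * u) \<otimes> x (3 *\<^sub>R a + 2 *\<^sub>R b) (of_int (- 3 * \<epsilon>\<^sub>2 * \<epsilon>\<^sub>5) * t * u^2)
    \<and> commutator G (x (2 *\<^sub>R a + b) u) (x a t)
      = x (3 *\<^sub>R a + b) (of_int (- 3 * \<epsilon>\<^sub>3) * t * u)
    \<and> commutator G (x (3 *\<^sub>R a + b) u) (x b t)
      = x (3 *\<^sub>R a + 2 *\<^sub>R b) (of_int (- \<epsilon>\<^sub>4) * t * u)
    \<and> commutator G (x (2 *\<^sub>R a + b) u) (x (a + b) t)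
      = x (3 *\<^sub>R a + 2 *\<^sub>R b) (of_int (3 * \<epsilon>\<^sub>5) * t * u)
    \<and> commutator G (x (- b) u) (x (- a) t)
      = x (- a - b) (of_int \<epsilon>\<^sub>1 * t * u) \<otimes> x (- 2 *\<^sub>R a - b) (of_int (\<epsilon>\<^sub>1 * \<epsilon>\<^sub>2) * t^2 * u)
          \<otimes> x (- 3 *\<^sub>R a - b) (of_int (\<epsilon>\<^sub>1 * \<epsilon>\<^sub>2 * \<epsilon>\<^sub>3) * t^3 * u) \<otimes> x (- 3 *\<^sub>R a - 2 *\<^sub>R b) (of_int (- \<epsilon>\<^sub>2 * \<epsilon>\<^sub>5) * t^3 * u^2)
    \<and> commutator G (x (- a) u) (x (- b) t)
      = x (- a - b) (of_int (- \<epsilon>\<^sub>1) * t * u) \<otimes> x (- 2 *\<^sub>R a - b) (of_int (- \<epsilon>\<^sub>1 * \<epsilon>\<^sub>2) * t * u^2)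
          \<otimes> x (- 3 *\<^sub>R a - b) (of_int (- \<epsilon>\<^sub>1 * \<epsilon>\<^sub>2 * \<epsilon>\<^sub>3) * t * u^3) \<otimes> x (- 3 *\<^sub>R a - 2 *\<^sub>R b) (of_int (- 2 * \<epsilon>\<^sub>2 * \<epsilon>\<^sub>5) * t^2 * u^3)
    \<and> commutator G (x (- a - b) u) (x (- a) t)
      = x (- 2 *\<^sub>R a - b) (of_int (2 * \<epsilon>\<^sub>2) * t * u) \<otimes> x (- 3 *\<^sub>R a - b) (of_int (3 * \<epsilon>\<^sub>2 * \<epsilon>\<^sub>3) * t^2 * u) \<otimes> x (- 3 *\<^sub>R a - 2 *\<^sub>R b) (of_int (- 3 * \<epsilon>\<^sub>2 * \<epsilon>\<^sub>5) * t * u^2)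
    \<and> commutator G (x (- 2 *\<^sub>R a - b) u) (x (- a) t)
      = x (- 3 *\<^sub>R a - b) (of_int (3 * \<epsilon>\<^sub>3) * t * u)
    \<and> commutator G (x (- 3 *\<^sub>R a - b) u) (x (- b) t)
      = x (- 3 *\<^sub>R a - 2 *\<^sub>R b) (of_int \<epsilon>\<^sub>4 * t * u)
    \<and> commutator G (x (- 2 *\<^sub>R a - b) u) (x (- a - b) t)
      = x (- 3 *\<^sub>R a - 2 *\<^sub>R b) (of_int (- 3 * \<epsilon>\<^sub>5) * t * u)
    \<and> commutator G (x (- a - b) u) (x a t)
      = x (- b) (of_int (3 * \<epsilon>\<^sub>1) * t * u)
    \<and> commutator G (x (- 2 *\<^sub>R a - b) u) (x a t)
      = x (- a - b) (of_int (2 * \<epsilon>\<^sub>2) * t * u) \<otimes> x (- b) (of_int (3 * \<epsilon>\<^sub>1 * \<epsilon>\<^sub>2) * t^2 * u) \<otimes> x (- 3 *\<^sub>R a - 2 *\<^sub>R b) (of_int (3 * \<epsilon>\<^sub>2 * \<epsilon>\<^sub>5) * t * u^2)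
    \<and> commutator G (x (- 3 *\<^sub>R a - b) u) (x a t)
      = x (- 2 *\<^sub>R a - b) (of_int \<epsilon>\<^sub>3 * t * u) \<otimes> x (- a - b) (of_int (\<epsilon>\<^sub>2 * \<epsilon>\<^sub>3) * t^2 * u)
          \<otimes> x (- b) (of_int (\<epsilon>\<^sub>1 * \<epsilon>\<^sub>2 * \<epsilon>\<^sub>3) * t^3 * u) \<otimes> x (- 3 *\<^sub>R a - 2 *\<^sub>R b) (of_int (\<epsilon>\<^sub>2 * \<epsilon>\<^sub>5) * t^3 * u^2)
    \<and> commutator G (x a u) (x (- 3 *\<^sub>R a - b) t)
      = x (- 2 *\<^sub>R a - b) (of_int (- \<epsilon>\<^sub>3) * t * u) \<otimes> x (- a - b) (of_int (- \<epsilon>\<^sub>2 * \<epsilon>\<^sub>3) * t * u^2)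
          \<otimes> x (- b) (of_int (- \<epsilon>\<^sub>1 * \<epsilon>\<^sub>2 * \<epsilon>\<^sub>3) * t * u^3) \<otimes> x (- 3 *\<^sub>R a - 2 *\<^sub>R b) (of_int (2 * \<epsilon>\<^sub>2 * \<epsilon>\<^sub>5) * t^2 * u^3)
    \<and> commutator G (x b u) (x (- a - b) t)
      = x (- a) (of_int \<epsilon>\<^sub>1 * t * u) \<otimes> x (- 2 *\<^sub>R a - b) (of_int (- \<epsilon>\<^sub>1 * \<epsilon>\<^sub>2) * t^2 * u)
          \<otimes> x (- 3 *\<^sub>R a - 2 *\<^sub>R b) (of_int (\<epsilon>\<^sub>1 * \<epsilon>\<^sub>2 * \<epsilon>\<^sub>5) * t^3 * u) \<otimes> x (- 3 *\<^sub>R a - b) (of_int (- \<epsilon>\<^sub>2 * \<epsilon>\<^sub>3) * t^3 * u^2)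
    \<and> commutator G (x (- a - b) u) (x b t)
      = x (- a) (of_int (- \<epsilon>\<^sub>1) * t * u) \<otimes> x (- 2 *\<^sub>R a - b) (of_int (\<epsilon>\<^sub>1 * \<epsilon>\<^sub>2) * t * u^2)
          \<otimes> x (- 3 *\<^sub>R a - 2 *\<^sub>R b) (of_int (- \<epsilon>\<^sub>1 * \<epsilon>\<^sub>2 * \<epsilon>\<^sub>5) * t * u^3) \<otimes> x (- 3 *\<^sub>R a - b) (of_int (- 2 * \<epsilon>\<^sub>2 * \<epsilon>\<^sub>3) * t^2 * u^3)
    \<and> commutator G (x (- 3 *\<^sub>R a - 2 *\<^sub>R b) u) (x b t)
      = x (- 3 *\<^sub>R a - b) (of_int \<epsilon>\<^sub>4 * t * u)
    \<and> commutator G (x (- a) u) (x (a + b) t)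
      = x b (of_int (3 * \<epsilon>\<^sub>1) * t * u)
    \<and> commutator G (x (- b) u) (x (a + b) t)
      = x a (of_int (- \<epsilon>\<^sub>1) * t * u) \<otimes> x (2 *\<^sub>R a + b) (of_int (- \<epsilon>\<^sub>1 * \<epsilon>\<^sub>2) * t^2 * u)
          \<otimes> x (3 *\<^sub>R a + 2 *\<^sub>R b) (of_int (- \<epsilon>\<^sub>1 * \<epsilon>\<^sub>2 * \<epsilon>\<^sub>5) * t^3 * u) \<otimes> x (3 *\<^sub>R a + b) (of_int (- \<epsilon>\<^sub>2 * \<epsilon>\<^sub>3) * t^3 * u^2)
    \<and> commutator G (x (a + b) u) (x (- b) t)
      = x a (of_int \<epsilon>\<^sub>1 * t * u) \<otimes> x (2 *\<^sub>R a + b) (of_int (\<epsilon>\<^sub>1 * \<epsilon>\<^sub>2) * t * u^2)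
          \<otimes> x (3 *\<^sub>R a + 2 *\<^sub>R b) (of_int (\<epsilon>\<^sub>1 * \<epsilon>\<^sub>2 * \<epsilon>\<^sub>5) * t * u^3) \<otimes> x (3 *\<^sub>R a + b) (of_int (- 2 * \<epsilon>\<^sub>2 * \<epsilon>\<^sub>3) * t^2 * u^3)
    \<and> commutator G (x (- 2 *\<^sub>R a - b) u) (x (a + b) t)
      = x (- a) (of_int (- 2 * \<epsilon>\<^sub>2) * t * u) \<otimes> x b (of_int (- 3 * \<epsilon>\<^sub>1 * \<epsilon>\<^sub>2) * t^2 * u) \<otimes> x (- 3 *\<^sub>R a - b) (of_int (3 * \<epsilon>\<^sub>2 * \<epsilon>\<^sub>3) * t * u^2)
    \<and> commutator G (x (- 3 *\<^sub>R a - 2 *\<^sub>R b) u) (x (a + b) t)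
      = x (- 2 *\<^sub>R a - b) (of_int (- \<epsilon>\<^sub>5) * t * u) \<otimes> x (- a) (of_int (\<epsilon>\<^sub>2 * \<epsilon>\<^sub>5) * t^2 * u)
          \<otimes> x b (of_int (\<epsilon>\<^sub>1 * \<epsilon>\<^sub>2 * \<epsilon>\<^sub>5) * t^3 * u) \<otimes> x (- 3 *\<^sub>R a - b) (of_int (\<epsilon>\<^sub>2 * \<epsilon>\<^sub>3) * t^3 * u^2)
    \<and> commutator G (x (a + b) u) (x (- 3 *\<^sub>R a - 2 *\<^sub>R b) t)
      = x (- 2 *\<^sub>R a - b) (of_int \<epsilon>\<^sub>5 * t * u) \<otimes> x (- a) (of_int (- \<epsilon>\<^sub>2 * \<epsilon>\<^sub>5) * t * u^2)
          \<otimes> x b (of_int (- \<epsilon>\<^sub>1 * \<epsilon>\<^sub>2 * \<epsilon>\<^sub>5) * t * u^3) \<otimes> x (- 3 *\<^sub>R a - b) (of_int (2 * \<epsilon>\<^sub>2 * \<epsilon>\<^sub>3) * t^2 * u^3)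
    \<and> commutator G (x (- a) u) (x (2 *\<^sub>R a + b) t)
      = x (a + b) (of_int (2 * \<epsilon>\<^sub>2) * t * u) \<otimes> x (3 *\<^sub>R a + 2 *\<^sub>R b) (of_int (- 3 * \<epsilon>\<^sub>2 * \<epsilon>\<^sub>5) * t^2 * u) \<otimes> x b (of_int (- 3 * \<epsilon>\<^sub>1 * \<epsilon>\<^sub>2) * t * u^2)
    \<and> commutator G (x (- a - b) u) (x (2 *\<^sub>R a + b) t)
      = x a (of_int (- 2 * \<epsilon>\<^sub>2) * t * u) \<otimes> x (3 *\<^sub>R a + b) (of_int (- 3 * \<epsilon>\<^sub>2 * \<epsilon>\<^sub>3) * t^2 * u) \<otimes> x (- b) (of_int (3 * \<epsilon>\<^sub>1 * \<epsilon>\<^sub>2) * t * u^2)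
    \<and> commutator G (x (- 3 *\<^sub>R a - b) u) (x (2 *\<^sub>R a + b) t)
      = x (- a) (of_int (- \<epsilon>\<^sub>3) * t * u) \<otimes> x (a + b) (of_int (- \<epsilon>\<^sub>2 * \<epsilon>\<^sub>3) * t^2 * u)
          \<otimes> x (3 *\<^sub>R a + 2 *\<^sub>R b) (of_int (\<epsilon>\<^sub>2 * \<epsilon>\<^sub>3 * \<epsilon>\<^sub>5) * t^3 * u) \<otimes> x b (of_int (- \<epsilon>\<^sub>1 * \<epsilon>\<^sub>2) * t^3 * u^2)
    \<and> commutator G (x (2 *\<^sub>R a + b) u) (x (- 3 *\<^sub>R a - b) t)
      = x (- a) (of_int \<epsilon>\<^sub>3 * t * u) \<otimes> x (a + b) (of_int (\<epsilon>\<^sub>2 * \<epsilon>\<^sub>3) * t * u^2)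
          \<otimes> x (3 *\<^sub>R a + 2 *\<^sub>R b) (of_int (- \<epsilon>\<^sub>2 * \<epsilon>\<^sub>3 * \<epsilon>\<^sub>5) * t * u^3) \<otimes> x b (of_int (- 2 * \<epsilon>\<^sub>1 * \<epsilon>\<^sub>2) * t^2 * u^3)
    \<and> commutator G (x (- 3 *\<^sub>R a - 2 *\<^sub>R b) u) (x (2 *\<^sub>R a + b) t)
      = x (- a - b) (of_int \<epsilon>\<^sub>5 * t * u) \<otimes> x a (of_int (- \<epsilon>\<^sub>2 * \<epsilon>\<^sub>5) * t^2 * u)
          \<otimes> x (3 *\<^sub>R a + b) (of_int (- \<epsilon>\<^sub>2 * \<epsilon>\<^sub>3 * \<epsilon>\<^sub>5) * t^3 * u) \<otimes> x (- b) (of_int (\<epsilon>\<^sub>1 * \<epsilon>\<^sub>2) * t^3 * u^2)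
    \<and> commutator G (x (2 *\<^sub>R a + b) u) (x (- 3 *\<^sub>R a - 2 *\<^sub>R b) t)
      = x (- a - b) (of_int (- \<epsilon>\<^sub>5) * t * u) \<otimes> x a (of_int (\<epsilon>\<^sub>2 * \<epsilon>\<^sub>5) * t * u^2)
          \<otimes> x (3 *\<^sub>R a + b) (of_int (\<epsilon>\<^sub>2 * \<epsilon>\<^sub>3 * \<epsilon>\<^sub>5) * t * u^3) \<otimes> x (- b) (of_int (2 * \<epsilon>\<^sub>1 * \<epsilon>\<^sub>2) * t^2 * u^3)
    \<and> commutator G (x (- a) u) (x (3 *\<^sub>R a + b) t)
      = x (2 *\<^sub>R a + b) (of_int \<epsilon>\<^sub>3 * t * u) \<otimes> x (a + b) (of_int (- \<epsilon>\<^sub>2 * \<epsilon>\<^sub>3) * t * u^2)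
          \<otimes> x b (of_int (\<epsilon>\<^sub>1 * \<epsilon>\<^sub>2 * \<epsilon>\<^sub>3) * t * u^3) \<otimes> x (3 *\<^sub>R a + 2 *\<^sub>R b) (of_int (2 * \<epsilon>\<^sub>2 * \<epsilon>\<^sub>5) * t^2 * u^3)
    \<and> commutator G (x (3 *\<^sub>R a + b) u) (x (- a) t)
      = x (2 *\<^sub>R a + b) (of_int (- \<epsilon>\<^sub>3) * t * u) \<otimes> x (a + b) (of_int (\<epsilon>\<^sub>2 * \<epsilon>\<^sub>3) * t^2 * u)
          \<otimes> x b (of_int (- \<epsilon>\<^sub>1 * \<epsilon>\<^sub>2 * \<epsilon>\<^sub>3) * t^3 * u) \<otimes> x (3 *\<^sub>R a + 2 *\<^sub>R b) (of_int (\<epsilon>\<^sub>2 * \<epsilon>\<^sub>5) * t^3 * u^2)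
    \<and> commutator G (x (- 2 *\<^sub>R a - b) u) (x (3 *\<^sub>R a + b) t)
      = x a (of_int (- \<epsilon>\<^sub>3) * t * u) \<otimes> x (- a - b) (of_int (\<epsilon>\<^sub>2 * \<epsilon>\<^sub>3) * t * u^2)
          \<otimes> x (- 3 *\<^sub>R a - 2 *\<^sub>R b) (of_int (\<epsilon>\<^sub>2 * \<epsilon>\<^sub>3 * \<epsilon>\<^sub>5) * t * u^3) \<otimes> x (- b) (of_int (- 2 * \<epsilon>\<^sub>1 * \<epsilon>\<^sub>2) * t^2 * u^3)
    \<and> commutator G (x (3 *\<^sub>R a + b) u) (x (- 2 *\<^sub>R a - b) t)
      = x a (of_int \<epsilon>\<^sub>3 * t * u) \<otimes> x (- a - b) (of_int (- \<epsilon>\<^sub>2 * \<epsilon>\<^sub>3) * t^2 * u)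
          \<otimes> x (- 3 *\<^sub>R a - 2 *\<^sub>R b) (of_int (- \<epsilon>\<^sub>2 * \<epsilon>\<^sub>3 * \<epsilon>\<^sub>5) * t^3 * u) \<otimes> x (- b) (of_int (- \<epsilon>\<^sub>1 * \<epsilon>\<^sub>2) * t^3 * u^2)
    \<and> commutator G (x (- 3 *\<^sub>R a - 2 *\<^sub>R b) u) (x (3 *\<^sub>R a + b) t)
      = x (- b) (of_int (- \<epsilon>\<^sub>4) * t * u)
    \<and> commutator G (x (- a - b) u) (x (3 *\<^sub>R a + 2 *\<^sub>R b) t)
      = x (2 *\<^sub>R a + b) (of_int (- \<epsilon>\<^sub>5) * t * u) \<otimes> x a (of_int (- \<epsilon>\<^sub>2 * \<epsilon>\<^sub>5) * t * u^2)
          \<otimes> x (- b) (of_int (\<epsilon>\<^sub>1 * \<epsilon>\<^sub>2 * \<epsilon>\<^sub>5) * t * u^3) \<otimes> x (3 *\<^sub>R a + b) (of_int (2 * \<epsilon>\<^sub>2 * \<epsilon>\<^sub>3) * t^2 * u^3)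
    \<and> commutator G (x (3 *\<^sub>R a + 2 *\<^sub>R b) u) (x (- a - b) t)
      = x (2 *\<^sub>R a + b) (of_int \<epsilon>\<^sub>5 * t * u) \<otimes> x a (of_int (\<epsilon>\<^sub>2 * \<epsilon>\<^sub>5) * t^2 * u)
          \<otimes> x (- b) (of_int (- \<epsilon>\<^sub>1 * \<epsilon>\<^sub>2 * \<epsilon>\<^sub>5) * t^3 * u) \<otimes> x (3 *\<^sub>R a + b) (of_int (\<epsilon>\<^sub>2 * \<epsilon>\<^sub>3) * t^3 * u^2)
    \<and> commutator G (x (- 2 *\<^sub>R a - b) u) (x (3 *\<^sub>R a + 2 *\<^sub>R b) t)
      = x (a + b) (of_int \<epsilon>\<^sub>5 * t * u) \<otimes> x (- a) (of_int (\<epsilon>\<^sub>2 * \<epsilon>\<^sub>5) * t * u^2)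
          \<otimes> x (- 3 *\<^sub>R a - b) (of_int (- \<epsilon>\<^sub>2 * \<epsilon>\<^sub>3 * \<epsilon>\<^sub>5) * t * u^3) \<otimes> x b (of_int (2 * \<epsilon>\<^sub>1 * \<epsilon>\<^sub>2) * t^2 * u^3)
    \<and> commutator G (x (3 *\<^sub>R a + 2 *\<^sub>R b) u) (x (- 2 *\<^sub>R a - b) t)
      = x (a + b) (of_int (- \<epsilon>\<^sub>5) * t * u) \<otimes> x (- a) (of_int (- \<epsilon>\<^sub>2 * \<epsilon>\<^sub>5) * t^2 * u)
          \<otimes> x (- 3 *\<^sub>R a - b) (of_int (\<epsilon>\<^sub>2 * \<epsilon>\<^sub>3 * \<epsilon>\<^sub>5) * t^3 * u) \<otimes> x b (of_int (\<epsilon>\<^sub>1 * \<epsilon>\<^sub>2) * t^3 * u^2)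
    \<and> commutator G (x (- 3 *\<^sub>R a - b) u) (x (3 *\<^sub>R a + 2 *\<^sub>R b) t)
      = x b (of_int (- \<epsilon>\<^sub>4) * t * u)"
proof -
  interpret G2_base cscale bracket h e N a b \<epsilon>\<^sub>1 \<epsilon>\<^sub>2 \<epsilon>\<^sub>3 \<epsilon>\<^sub>4
    using G2_chevalley_basis.G2_base_a_b assms(5-9) unfolding a_def b_def by blast
  \<comment> \<open>A sign is its own inverse, so the real quotient that defines
    \<open>\<epsilon>\<^sub>5\<close> is a product of integers.\<close>
  have "\<epsilon>\<^sub>4 = 1 \<or> \<epsilon>\<^sub>4 = - 1"
    using sign(4) by (metis mult_minus_left zmult_eq_1_iff)
  then have \<epsilon>\<^sub>5: "\<epsilon>\<^sub>5 = \<epsilon>\<^sub>1 * \<epsilon>\<^sub>3 * \<epsilon>\<^sub>4"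
    using assms(10) by (auto simp flip: of_int_mult of_int_minus)
  note instance_simps = vec_eq_iff root_comb_comb root_comb_def \<epsilon>\<^sub>5 signs algebra_simps
  \<comment> \<open>For the commutator of x_\<alpha> and x_\<beta> the base (r, s) is read off from
    the kind of the pair: (\<beta>, \<alpha>) for long and short, (\<alpha>, \<beta>) for short and
    long, (\<beta>, \<alpha> - \<beta>) for two short roots at 120 degrees, ((\<alpha> - \<beta>)/3,
    \<beta>) for two long roots, and (\<alpha> - \<beta>, 2\<beta> - \<alpha>) for two short roots
    at 60 degrees.\<close>
  show ?thesis
    unfolding x_def G_def
  proof (intro conjI, goal_cases)
    case 1
    show ?case by (rule G2_base.commutator_long_short[OF bases(1)]; simp add: instance_simps)
  next
    case 2
    show ?case by (rule G2_base.commutator_short_long[OF bases(1)]; simp add: instance_simps)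
  next
    case 3
    show ?case by (rule G2_base.commutator_short_short_120[OF bases(1)]; simp add: instance_simps)
  next
    case 4
    \<comment> \<open>Here 2a + b = 2r + s and a = r + s for r = a + b and s = -b; the fifth sign of
      this base is \<open>- \<epsilon>\<^sub>3\<close>.\<close>
    show ?case by (rule G2_base.commutator_short_short_60[OF bases(3)]; simp add: instance_simps)
  next
    case 5
    show ?case by (rule G2_base.commutator_long_long[OF bases(1)]; simp add: instance_simps)
  next
    case 6
    show ?case by (rule G2_base.commutator_short_short_60[OF bases(1)]; simp add: instance_simps)
  next
    case 7
    show ?case by (rule G2_base.commutator_long_short[OF bases(8)]; simp add: instance_simps)
  next
    case 8
    show ?case by (rule G2_base.commutator_short_long[OF bases(8)]; simp add: instance_simps)
  next
    case 9
    show ?case by (rule G2_base.commutator_short_short_120[OF bases(8)]; simp add: instance_simps)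
  next
    case 10
    show ?case by (rule G2_base.commutator_short_short_60[OF bases(9)]; simp add: instance_simps)
  next
    case 11
    show ?case by (rule G2_base.commutator_long_long[OF bases(8)]; simp add: instance_simps)
  next
    case 12
    show ?case by (rule G2_base.commutator_short_short_60[OF bases(8)]; simp add: instance_simps)
  next
    case 13
    show ?case by (rule G2_base.commutator_short_short_60[OF bases(11)]; simp add: instance_simps)
  next
    case 14
    show ?case by (rule G2_base.commutator_short_short_120[OF bases(2)]; simp add: instance_simps)
  next
    case 15
    show ?case by (rule G2_base.commutator_long_short[OF bases(2)]; simp add: instance_simps)
  next
    case 16
    show ?case by (rule G2_base.commutator_short_long[OF bases(2)]; simp add: instance_simps)
  next
    case 17
    show ?case by (rule G2_base.commutator_long_short[OF bases(9)]; simp add: instance_simps)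
  next
    case 18
    show ?case by (rule G2_base.commutator_short_long[OF bases(9)]; simp add: instance_simps)
  next
    case 19
    show ?case by (rule G2_base.commutator_long_long[OF bases(9)]; simp add: instance_simps)
  next
    case 20
    show ?case by (rule G2_base.commutator_short_short_60[OF bases(12)]; simp add: instance_simps)
  next
    case 21
    show ?case by (rule G2_base.commutator_long_short[OF bases(3)]; simp add: instance_simps)
  next
    case 22
    show ?case by (rule G2_base.commutator_short_long[OF bases(3)]; simp add: instance_simps)
  next
    case 23
    show ?case by (rule G2_base.commutator_short_short_120[OF bases(4)]; simp add: instance_simps)
  next
    case 24
    show ?case by (rule G2_base.commutator_long_short[OF bases(4)]; simp add: instance_simps)
  next
    case 25
    show ?case by (rule G2_base.commutator_short_long[OF bases(4)]; simp add: instance_simps)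
  next
    case 26
    show ?case by (rule G2_base.commutator_short_short_120[OF bases(5)]; simp add: instance_simps)
  next
    case 27
    show ?case by (rule G2_base.commutator_short_short_120[OF bases(6)]; simp add: instance_simps)
  next
    case 28
    show ?case by (rule G2_base.commutator_long_short[OF bases(5)]; simp add: instance_simps)
  next
    case 29
    show ?case by (rule G2_base.commutator_short_long[OF bases(5)]; simp add: instance_simps)
  next
    case 30
    show ?case by (rule G2_base.commutator_long_short[OF bases(6)]; simp add: instance_simps)
  next
    case 31
    show ?case by (rule G2_base.commutator_short_long[OF bases(6)]; simp add: instance_simps)
  next
    case 32
    show ?case by (rule G2_base.commutator_short_long[OF bases(7)]; simp add: instance_simps)
  next
    case 33
    show ?case by (rule G2_base.commutator_long_short[OF bases(7)]; simp add: instance_simps)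
  next
    case 34
    show ?case by (rule G2_base.commutator_short_long[OF bases(11)]; simp add: instance_simps)
  next
    case 35
    show ?case by (rule G2_base.commutator_long_short[OF bases(11)]; simp add: instance_simps)
  next
    case 36
    show ?case by (rule G2_base.commutator_long_long[OF bases(11)]; simp add: instance_simps)
  next
    case 37
    show ?case by (rule G2_base.commutator_short_long[OF bases(10)]; simp add: instance_simps)
  next
    case 38
    show ?case by (rule G2_base.commutator_long_short[OF bases(10)]; simp add: instance_simps)
  next
    case 39
    show ?case by (rule G2_base.commutator_short_long[OF bases(12)]; simp add: instance_simps)
  next
    case 40
    show ?case by (rule G2_base.commutator_long_short[OF bases(12)]; simp add: instance_simps)
  next
    case 41
    show ?case by (rule G2_base.commutator_long_long[OF bases(12)]; simp add: instance_simps)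
  qed
qed

end
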